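(* Let $v$ be a viscosity solution of $H(x,c+v_x)=h(c)$ on $\mathbb{T}^n$ corresponding to a KAM torus with a $(\nu,\eta)$-Diophantine rotation vector, and for $\varepsilon>0$ let $v^\varepsilon$ be the unique viscosity solution of $\varepsilon v^\varepsilon+H(x,c+v^\varepsilon_x)=h(c)$ on $\mathbb{T}^n$. Then there exists a constant $\beta>0$ independent of $\varepsilon$ such that, after adding to $v$ a constant which may depend on $\varepsilon$, $$\|v^\varepsilon-v\|_{C^0(\mathbb{T}^n)}\le\beta\,\varepsilon^{\frac{1}{1+2\eta}}\quad\text{as }\varepsilon\to0.$$
   Context: $H:\mathbb{T}^n\times\mathbb{R}^n\to\mathbb{R}$ is $C^2$, $H_{pp}$ is positive definite, $H(x,p)/|p|\to+\infty$ as $|p|\to\infty$ uniformly in $x$. $c\in\mathbb{R}^n$ is fixed and $h(c)$ is the unique constant for which $H(x,c+v_x)=h(c)$ has a viscosity solution on $\mathbb{T}^n$. $\phi^s_H$ is the flow of $x'=H_p(x,p)$, $p'=-H_x(x,p)$. $\mathrm{graph}(c+v_x):=\{(x,c+v_x(x)): v\text{ differentiable at }x\}$. "$v$ corresponds to a KAM torus with a $(\nu,\eta)$-Diophantine rotation vector $\omega\in\mathbb{R}^n$" means: $\mathrm{graph}(c+v_x)$ is a smooth $\phi^s_H$-invariant torus and there is a $C^1$ embedding $\Phi=(\varphi,\psi):\mathbb{T}^n\to\mathbb{T}^n\times\mathbb{R}^n$ with $\Phi(\mathbb{T}^n)=\mathrm{graph}(c+v_x)$ such that for every $(x_0,p_0)\in\mathrm{graph}(c+v_x)$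 there is $\theta_0\in\mathbb{T}^n$ (depending on $(x_0,p_0)$) with $\phi^s_H(x_0,p_0)=\Phi(\omega s+\theta_0)$ for all $s$, and $|\omega\cdot z|\ge\nu(|z_1|+\dots+|z_n|)^{-\eta}$ for all $z\in\mathbb{Z}^n\setminus\{0\}$, where $\nu>0$, $\eta>n-1$. *)

theory Defs
  imports "HOL-Analysis.Analysis"
begin

text \<open>The torus T^n is represented through Z^n-periodic lifts on real^'n.\<close>

definition int_vec :: "real^'n \<Rightarrow> bool" where
  "int_vec z \<longleftrightarrow> (\<forall>i. z $ i \<in> \<int>)"

definition tor_eq :: "real^'n \<Rightarrow> real^'n \<Rightarrow> bool" where
  "tor_eq x y \<longleftrightarrow> int_vec (x - y)"

definition periodic_fun :: "(real^'n \<Rightarrow> 'b) \<Rightarrow> bool" where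
  "periodic_fun f \<longleftrightarrow> (\<forall>x z. int_vec z \<longrightarrow> f (x + z) = f x)"

definition C1_map :: "('a::euclidean_space \<Rightarrow> 'b::real_normed_vector) \<Rightarrow> bool" where
  "C1_map f \<longleftrightarrow> (\<exists>f'. (\<forall>y. (f has_derivative blinfun_apply (f' y)) (at y)) \<and> continuous_on UNIV f')"

definition C2_fun :: "('a::euclidean_space \<Rightarrow> real) \<Rightarrow> bool" where
  "C2_fun f \<longleftrightarrow> (\<exists>G G'. (\<forall>z. (f has_derivative (\<lambda>k. G z \<bullet> k)) (at z)) \<and>
      (\<forall>z. (G has_derivative blinfun_apply (G' z)) (at z)) \<and> continuous_on UNIV G')"

definition pderiv_dir :: "'a::euclidean_space \<Rightarrow> ('a \<Rightarrow> 'b::real_normed_vector) \<Rightarrow> 'a \<Rightarrow> 'b" where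
  "pderiv_dir e g y = frechet_derivative g (at y) e"

definition smooth_map :: "('a::euclidean_space \<Rightarrow> 'b::real_normed_vector) \<Rightarrow> bool" where
  "smooth_map f \<longleftrightarrow> (\<forall>es. set es \<subseteq> Basis \<longrightarrow> foldr pderiv_dir es f differentiable_on UNIV)"

definition immersion :: "('a::euclidean_space \<Rightarrow> 'b::real_normed_vector) \<Rightarrow> bool" where
  "immersion f \<longleftrightarrow> (\<exists>f'. (\<forall>y. (f has_derivative blinfun_apply (f' y)) (at y)) \<and>
      continuous_on UNIV f' \<and> (\<forall>y. inj (blinfun_apply (f' y))))"

definition Hx :: "(real^'n \<Rightarrow> real^'n \<Rightarrow> real) \<Rightarrow> real^'n \<Rightarrow> real^'n \<Rightarrow> real^'n" where
  "Hx H x p = (THE g. ((\<lambda>y. H y p) has_derivative (\<lambda>k. g \<bullet> k)) (at x))"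

definition Hp :: "(real^'n \<Rightarrow> real^'n \<Rightarrow> real) \<Rightarrow> real^'n \<Rightarrow> real^'n \<Rightarrow> real^'n" where
  "Hp H x p = (THE g. ((\<lambda>q. H x q) has_derivative (\<lambda>k. g \<bullet> k)) (at p))"

definition Hpp :: "(real^'n \<Rightarrow> real^'n \<Rightarrow> real) \<Rightarrow> real^'n \<Rightarrow> real^'n \<Rightarrow> real^'n \<Rightarrow> real^'n" where
  "Hpp H x p = (THE L. ((\<lambda>q. Hp H x q) has_derivative L) (at p))"

definition tonelli :: "(real^'n \<Rightarrow> real^'n \<Rightarrow> real) \<Rightarrow> bool" where
  "tonelli H \<longleftrightarrow>
     C2_fun (\<lambda>z. H (fst z) (snd z)) \<and>
     (\<forall>p. periodic_fun (\<lambda>x. H x p)) \<and>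
     (\<forall>x p v. v \<noteq> 0 \<longrightarrow> Hpp H x p v \<bullet> v > 0) \<and>
     (\<forall>M. \<exists>R. \<forall>x p. norm p \<ge> R \<longrightarrow> H x p \<ge> M * norm p)"

definition ham_traj :: "(real^'n \<Rightarrow> real^'n \<Rightarrow> real) \<Rightarrow> (real \<Rightarrow> (real^'n) \<times> (real^'n)) \<Rightarrow> bool" where
  "ham_traj H \<gamma> \<longleftrightarrow> (\<forall>s. (\<gamma> has_vector_derivative
      (Hp H (fst (\<gamma> s)) (snd (\<gamma> s)), - Hx H (fst (\<gamma> s)) (snd (\<gamma> s)))) (at s))"

definition ham_flow :: "(real^'n \<Rightarrow> real^'n \<Rightarrow> real) \<Rightarrow> real \<Rightarrow> (real^'n) \<times> (real^'n) \<Rightarrow> (real^'n) \<times> (real^'n)" where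
  "ham_flow H s z = (THE \<gamma>. ham_traj H \<gamma> \<and> \<gamma> 0 = z) s"

definition C1_test :: "(real^'n \<Rightarrow> real) \<Rightarrow> (real^'n \<Rightarrow> real^'n) \<Rightarrow> bool" where
  "C1_test \<phi> D\<phi> \<longleftrightarrow> continuous_on UNIV D\<phi> \<and> (\<forall>y. (\<phi> has_derivative (\<lambda>k. D\<phi> y \<bullet> k)) (at y))"

definition viscosity_solution ::
  "(real^'n \<Rightarrow> real \<Rightarrow> real^'n \<Rightarrow> real) \<Rightarrow> (real^'n \<Rightarrow> real) \<Rightarrow> bool" where
  "viscosity_solution F u \<longleftrightarrow>
     continuous_on UNIV u \<and> periodic_fun u \<and>
     (\<forall>\<phi> D\<phi> x. C1_test \<phi> D\<phi> \<and> (\<exists>r>0. \<forall>y\<in>ball x r. u y - \<phi> y \<le> u x - \<phi> x)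
         \<longrightarrow> F x (u x) (D\<phi> x) \<le> 0) \<and>
     (\<forall>\<phi> D\<phi> x. C1_test \<phi> D\<phi> \<and> (\<exists>r>0. \<forall>y\<in>ball x r. u y - \<phi> y \<ge> u x - \<phi> x)
         \<longrightarrow> F x (u x) (D\<phi> x) \<ge> 0)"

definition graph_c :: "real^'n \<Rightarrow> (real^'n \<Rightarrow> real) \<Rightarrow> ((real^'n) \<times> (real^'n)) set" where
  "graph_c c v = {(x, c + g) | x g. (v has_derivative (\<lambda>k. g \<bullet> k)) (at x)}"

text \<open>(a, b) are lifts of an embedding T^n -> T^n x R^n with image S (S periodic in x).\<close>

definition torus_embedding ::
  "(real^'n \<Rightarrow> real^'n) \<Rightarrow> (real^'n \<Rightarrow> real^'n) \<Rightarrow> ((real^'n) \<times> (real^'n)) set \<Rightarrow> bool" where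
  "torus_embedding a b S \<longleftrightarrow>
     (\<forall>\<theta> k. int_vec k \<longrightarrow> int_vec (a (\<theta> + k) - a \<theta>) \<and> b (\<theta> + k) = b \<theta>) \<and>
     (\<forall>\<theta> \<theta>'. tor_eq (a \<theta>) (a \<theta>') \<and> b \<theta> = b \<theta>' \<longrightarrow> tor_eq \<theta> \<theta>') \<and>
     immersion (\<lambda>\<theta>. (a \<theta>, b \<theta>)) \<and>
     (\<forall>\<theta>. (a \<theta>, b \<theta>) \<in> S) \<and>
     (\<forall>x p. (x, p) \<in> S \<longrightarrow> (\<exists>\<theta>. tor_eq x (a \<theta>) \<and> p = b \<theta>))"

definition diophantine :: "real \<Rightarrow> real \<Rightarrow> real^'n \<Rightarrow> bool" where
  "diophantine \<nu> \<eta> \<omega> \<longleftrightarrow> \<nu> > 0 \<and> \<eta> > real CARD('n) - 1 \<and>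
     (\<forall>z. int_vec z \<and> z \<noteq> 0 \<longrightarrow> \<bar>\<omega> \<bullet> z\<bar> \<ge> \<nu> * (\<Sum>i\<in>UNIV. \<bar>z $ i\<bar>) powr (- \<eta>))"

definition KAM_torus ::
  "(real^'n \<Rightarrow> real^'n \<Rightarrow> real) \<Rightarrow> real^'n \<Rightarrow> (real^'n \<Rightarrow> real) \<Rightarrow> real \<Rightarrow> real \<Rightarrow> real^'n \<Rightarrow> bool" where
  "KAM_torus H c v \<nu> \<eta> \<omega> \<longleftrightarrow>
     diophantine \<nu> \<eta> \<omega> \<and>
     \<comment> \<open>graph(c+v_x) is a smooth torus\<close>
     (\<exists>a b. smooth_map a \<and> smooth_map b \<and> torus_embedding a b (graph_c c v)) \<and>
     \<comment> \<open>invariant under the Hamiltonian flow\<close>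
     (\<forall>z\<in>graph_c c v. \<forall>s. ham_flow H s z \<in> graph_c c v) \<and>
     \<comment> \<open>C^1 parametrisation conjugating the flow to the linear flow with frequency omega\<close>
     (\<exists>\<phi> \<psi>. C1_map \<phi> \<and> C1_map \<psi> \<and> torus_embedding \<phi> \<psi> (graph_c c v) \<and>
        (\<forall>z\<in>graph_c c v. \<exists>\<theta>0. \<forall>s.
            tor_eq (fst (ham_flow H s z)) (\<phi> (s *\<^sub>R \<omega> + \<theta>0)) \<and>
            snd (ham_flow H s z) = \<psi> (s *\<^sub>R \<omega> + \<theta>0)))"

end

theory Submission
  imports Defs
begin

text \<open>Since the graph of \<open>c + v\<^sub>x\<close> is a torus, invariance of domain shows that \<open>v\<close> is \<open>C\<^sup>1\<close>. Testing
  with \<open>v\<close> itself bounds \<open>v\<^sup>\<epsilon>\<close> by the oscillation of \<open>v\<close>, and coercivity makes \<open>v\<^sup>\<epsilon>\<close> Lipschitz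
  uniformly in \<open>\<epsilon>\<close>. By convexity of \<open>H\<close> in \<open>p\<close>, the difference \<open>w = v\<^sup>\<epsilon> - v\<close> grows at rate at most
  \<open>O(\<epsilon>)\<close> along the characteristics of \<open>v\<close>, which are conjugate to the linear flow with frequency
  \<open>\<omega>\<close>. A Fourier argument shows that orbits of this flow of length \<open>O(\<delta>\<^bsup>-2\<eta>\<^esup>)\<close> are \<open>\<delta>\<close>-dense, so
  the oscillation of \<open>w\<close> is \<open>O(\<delta> + \<epsilon> \<delta>\<^bsup>-2\<eta>\<^esup>)\<close>, and \<open>\<delta> = \<epsilon>\<^bsup>1/(1+2\<eta>)\<^esup>\<close> balances the two terms.\<close>

section \<open>Globally Lipschitz differential equations\<close>

lemma exp_weighted_integral_bound:
  fixes f :: "real \<Rightarrow> 'a::banach"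
  assumes a: "0 < a" and r: "0 \<le> r" and integrable: "f integrable_on {0..r}"
    and growth: "\<And>t. t \<in> {0..r} \<Longrightarrow> norm (f t) \<le> M * exp (a * t)"
  shows "norm (exp (- (a * r)) *\<^sub>R integral {0..r} f) \<le> M / a"
proof -
  have M: "0 \<le> M" using growth[of 0] r norm_ge_zero[of "f 0"] by (simp del: norm_ge_zero)
  have "((\<lambda>t. M * exp (a * t)) has_integral M * exp (a * r) / a - M * exp (a * 0) / a) {0..r}"
    using a r by (intro fundamental_theorem_of_calculus)
      (auto intro!: derivative_eq_intros simp flip: has_real_derivative_iff_has_vector_derivative)
  then have "norm (integral {0..r} f) \<le> M * exp (a * r) / a - M / a"
    using integral_norm_bound_integral[OF integrable _ growth]
    by (metis exp_zero has_integral_integrable_integral mult.right_neutral mult_zero_right)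
  then have "norm (integral {0..r} f) \<le> exp (a * r) * (M / a)"
    using M a by (smt (verit) divide_nonneg_pos mult.commute times_divide_eq_left)
  then have "exp (- (a * r)) * norm (integral {0..r} f) \<le> exp (- (a * r)) * (exp (a * r) * (M / a))"
    by (rule mult_left_mono) simp
  also have "\<dots> = M / a" by (simp add: exp_minus)
  finally show ?thesis by simp
qed

text \<open>Writing a solution as \<open>\<gamma> s = z + exp (a s) \<beta> s\<close> turns the Picard operator into a contraction
  for the supremum norm of \<open>\<beta>\<close> once \<open>a\<close> exceeds the Lipschitz constant, so that a single fixed point
  covers all forward times.\<close>

definition weighted_picard :: "('a::banach \<Rightarrow> 'a) \<Rightarrow> real \<Rightarrow> 'a \<Rightarrow> (real \<Rightarrow> 'a) \<Rightarrow> real \<Rightarrow> 'a" where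
  "weighted_picard F a z \<beta> s =
     exp (- (a * max 0 s)) *\<^sub>R integral {0..max 0 s} (\<lambda>t. F (z + exp (a * t) *\<^sub>R \<beta> t))"

context
  fixes F :: "'a::banach \<Rightarrow> 'a" and L a :: real and z :: 'a
  assumes lipschitz: "L-lipschitz_on UNIV F" and rate: "L < a"
begin

private lemma rate_pos: "0 < a"
  using lipschitz_on_nonneg[OF lipschitz] rate by simp

lemma continuous_on_weighted_field:
  "continuous_on UNIV \<beta> \<Longrightarrow> continuous_on S (\<lambda>t. F (z + exp (a * t) *\<^sub>R \<beta> t))"
  by (intro continuous_on_compose2[OF lipschitz_on_continuous_on[OF lipschitz]] continuous_intros)
     (auto intro: continuous_on_subset)

lemma integrable_weighted_field:
  "continuous_on UNIV \<beta> \<Longrightarrow> (\<lambda>t. F (z + exp (a * t) *\<^sub>R \<beta> t)) integrable_on {0..r}"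
  by (intro integrable_continuous_interval continuous_on_weighted_field)

lemma has_vector_derivative_weighted_field:
  assumes "continuous_on UNIV \<beta>" "0 \<le> s"
  shows "((\<lambda>s. integral {0..s} (\<lambda>t. F (z + exp (a * t) *\<^sub>R \<beta> t))) has_vector_derivative
    F (z + exp (a * s) *\<^sub>R \<beta> s)) (at s within {0..})"
proof -
  have "at s within {0..s+1} = at s within {0..}"
    by (rule at_within_nhd[of s "{..<s+1}"]) auto
  then show ?thesis
    using integral_has_vector_derivative[of 0 "s + 1" _ s]
      continuous_on_weighted_field[OF assms(1)] assms(2)
    by fastforce
qed

lemma continuous_on_weighted_picard:
  assumes "continuous_on UNIV \<beta>"
  shows "continuous_on UNIV (weighted_picard F a z \<beta>)"
proof -
  have "continuous_on {0..} (\<lambda>s. integral {0..s} (\<lambda>t. F (z + exp (a * t) *\<^sub>R \<beta> t)))"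
    using has_vector_derivative_weighted_field[OF assms]
    by (intro continuous_on_vector_derivative) auto
  then have "continuous_on UNIV (\<lambda>s. integral {0..max 0 s} (\<lambda>t. F (z + exp (a * t) *\<^sub>R \<beta> t)))"
    by (rule continuous_on_compose2) (auto intro!: continuous_intros)
  then show ?thesis unfolding weighted_picard_def by (intro continuous_intros)
qed

lemma norm_weighted_picard_le:
  assumes "continuous_on UNIV \<beta>" and \<beta>: "\<And>t. norm (\<beta> t) \<le> B"
  shows "norm (weighted_picard F a z \<beta> s) \<le> (norm (F z) + L * B) / a"
  unfolding weighted_picard_def
proof (rule exp_weighted_integral_bound[OF rate_pos])
  fix t assume t: "t \<in> {0..max 0 s}"
  have "norm (F (z + exp (a * t) *\<^sub>R \<beta> t)) \<le> norm (F z) + L * (exp (a * t) * norm (\<beta> t))"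
    using lipschitz_on_normD[OF lipschitz, of "z + exp (a * t) *\<^sub>R \<beta> t" z]
      norm_triangle_sub[of "F (z + exp (a * t) *\<^sub>R \<beta> t)" "F z"] by simp
  also have "\<dots> \<le> norm (F z) * exp (a * t) + L * (exp (a * t) * B)"
    using t rate_pos \<beta>[of t] lipschitz_on_nonneg[OF lipschitz]
    by (intro add_mono mult_left_mono) (auto simp: mult_le_cancel_left1)
  finally show "norm (F (z + exp (a * t) *\<^sub>R \<beta> t)) \<le> (norm (F z) + L * B) * exp (a * t)"
    by (simp add: algebra_simps)
qed (auto intro: integrable_weighted_field assms)

lemma weighted_picard_contraction:
  assumes cont: "continuous_on UNIV \<beta>" "continuous_on UNIV \<beta>'"
    and dist: "\<And>t. norm (\<beta> t - \<beta>' t) \<le> D"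
  shows "norm (weighted_picard F a z \<beta> s - weighted_picard F a z \<beta>' s) \<le> L / a * D"
proof -
  let ?f = "\<lambda>\<beta> t. F (z + exp (a * t) *\<^sub>R \<beta> t)" and ?r = "max 0 s"
  have "norm (exp (- (a * ?r)) *\<^sub>R integral {0..?r} (\<lambda>t. ?f \<beta> t - ?f \<beta>' t)) \<le> (L * D) / a"
  proof (rule exp_weighted_integral_bound[OF rate_pos])
    fix t
    have "norm (?f \<beta> t - ?f \<beta>' t) \<le> L * (exp (a * t) * norm (\<beta> t - \<beta>' t))"
      using lipschitz_on_normD[OF lipschitz, of "z + exp (a * t) *\<^sub>R \<beta> t" "z + exp (a * t) *\<^sub>R \<beta>' t"]
      by (simp flip: scaleR_diff_right)
    also have "\<dots> \<le> L * (exp (a * t) * D)"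
      using dist[of t] lipschitz_on_nonneg[OF lipschitz] by (intro mult_left_mono) auto
    finally show "norm (?f \<beta> t - ?f \<beta>' t) \<le> (L * D) * exp (a * t)" by (simp add: algebra_simps)
  qed (auto intro!: integrable_diff integrable_weighted_field cont)
  then show ?thesis
    using integrable_weighted_field[OF cont(1)] integrable_weighted_field[OF cont(2)]
    by (simp add: weighted_picard_def Henstock_Kurzweil_Integration.integral_diff scaleR_diff_right)
qed

lemma weighted_picard_fixed_point:
  obtains \<beta> where "continuous_on UNIV \<beta>" "weighted_picard F a z \<beta> = \<beta>"
proof -
  let ?P = "\<lambda>\<beta> :: real \<Rightarrow>\<^sub>C 'a. weighted_picard F a z (apply_bcontfun \<beta>)"
  have "?P \<beta> \<in> bcontfun" for \<beta>
    by (rule bcontfun_normI[OF continuous_on_weighted_picard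
          norm_weighted_picard_le[OF _ norm_bounded]]) auto
  then have apply_P: "apply_bcontfun (Bcontfun (?P \<beta>)) = ?P \<beta>" for \<beta> by (rule Bcontfun_inverse)
  have "dist (Bcontfun (?P \<beta>)) (Bcontfun (?P \<beta>')) \<le> L / a * dist \<beta> \<beta>'" for \<beta> \<beta>'
  proof (rule dist_bound)
    show "dist (Bcontfun (?P \<beta>) s) (Bcontfun (?P \<beta>') s) \<le> L / a * dist \<beta> \<beta>'" for s
      using weighted_picard_contraction[of \<beta> \<beta>' "dist \<beta> \<beta>'"] dist_bounded[of \<beta> _ \<beta>']
      by (simp add: apply_P dist_norm)
  qed
  then have "\<exists>!\<beta>. Bcontfun (?P \<beta>) = \<beta>"
    using lipschitz_on_nonneg[OF lipschitz] rate_pos rate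
    by (intro banach_fix_type[where c = "L / a"]) auto
  then obtain \<beta> where "Bcontfun (?P \<beta>) = \<beta>" by auto
  then show ?thesis using apply_P[of \<beta>] that[of "apply_bcontfun \<beta>"] by simp
qed

end

lemma lipschitz_ode_forward:
  fixes F :: "'a::banach \<Rightarrow> 'a"
  assumes lipschitz: "L-lipschitz_on UNIV F"
  obtains \<gamma> where "\<gamma> 0 = z"
    "\<And>s. 0 \<le> s \<Longrightarrow> (\<gamma> has_vector_derivative F (\<gamma> s)) (at s within {0..})"
proof -
  define a where "a = L + 1"
  have rate: "L < a" by (simp add: a_def)
  obtain \<beta> where cont: "continuous_on UNIV \<beta>" and fixpoint: "weighted_picard F a z \<beta> = \<beta>"
    using weighted_picard_fixed_point[OF lipschitz rate] .
  define \<gamma> where "\<gamma> s = z + integral {0..s} (\<lambda>t. F (z + exp (a * t) *\<^sub>R \<beta> t))" for s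
  have \<gamma>: "\<gamma> s = z + exp (a * s) *\<^sub>R \<beta> s" if "0 \<le> s" for s
  proof -
    have "\<beta> s = exp (- (a * s)) *\<^sub>R (\<gamma> s - z)"
      using fun_cong[OF fixpoint, of s] that by (simp add: weighted_picard_def \<gamma>_def)
    then show ?thesis by (simp add: exp_minus)
  qed
  show ?thesis
  proof
    show "\<gamma> 0 = z" by (simp add: \<gamma>_def)
    show "(\<gamma> has_vector_derivative F (\<gamma> s)) (at s within {0..})" if "0 \<le> s" for s
      unfolding \<gamma>[OF that] unfolding \<gamma>_def[abs_def]
      using has_vector_derivative_weighted_field[OF lipschitz rate cont that]
      by (auto intro!: derivative_eq_intros)
  qed
qed

lemma lipschitz_ode_exists:
  fixes F :: "'a::banach \<Rightarrow> 'a"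
  assumes lipschitz: "L-lipschitz_on UNIV F"
  obtains \<gamma> where "\<gamma> 0 = z" "\<And>s. (\<gamma> has_vector_derivative F (\<gamma> s)) (at s)"
proof -
  obtain \<alpha> where \<alpha>: "\<alpha> 0 = z"
    "\<And>s. 0 \<le> s \<Longrightarrow> (\<alpha> has_vector_derivative F (\<alpha> s)) (at s within {0..})"
    using lipschitz_ode_forward[OF lipschitz] by blast
  obtain \<beta> where \<beta>: "\<beta> 0 = z"
    "\<And>s. 0 \<le> s \<Longrightarrow> (\<beta> has_vector_derivative - F (\<beta> s)) (at s within {0..})"
    using lipschitz_ode_forward[OF lipschitz_on_minus[OF lipschitz]] by blast
  have reversed: "((\<lambda>s. \<beta> (- s)) has_vector_derivative F (\<beta> (- s))) (at s within {..0})"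
    if "s \<le> 0" for s
  proof -
    have "uminus ` {..0::real} = {0..}" by auto
    then have "(\<beta> has_vector_derivative - F (\<beta> (- s))) (at (- s) within uminus ` {..0})"
      using \<beta>(2)[of "- s"] that by simp
    then have "((\<beta> \<circ> uminus) has_vector_derivative (-1) *\<^sub>R - F (\<beta> (- s))) (at s within {..0})"
      by (intro vector_diff_chain_within) (auto intro!: derivative_eq_intros)
    then show ?thesis by (simp add: o_def)
  qed
  let ?\<gamma> = "\<lambda>s. if s \<in> {0..} then \<alpha> s else \<beta> (- s)"
  have "(?\<gamma> has_vector_derivative (if s \<in> {0..} then F (\<alpha> s) else F (\<beta> (- s)))) (at s within UNIV)"
    for s
  proof (rule has_vector_derivative_If_within_closures[where T = "{..0}"])
    have "{0..} \<union> {0..} \<inter> {..0::real} = {0..}" "{..0} \<union> {0..} \<inter> {..0::real} = {..0}" by auto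
    then show "s \<in> {0..} \<union> closure {0..} \<inter> closure {..0} \<Longrightarrow>
        (\<alpha> has_vector_derivative F (\<alpha> s)) (at s within {0..} \<union> closure {0..} \<inter> closure {..0})"
      "s \<in> {..0} \<union> closure {0..} \<inter> closure {..0} \<Longrightarrow>
        ((\<lambda>s. \<beta> (- s)) has_vector_derivative F (\<beta> (- s)))
          (at s within {..0} \<union> closure {0..} \<inter> closure {..0})"
      using \<alpha>(2)[of s] reversed[of s] by auto
  qed (use \<alpha>(1) \<beta>(1) in auto)
  then have "(?\<gamma> has_vector_derivative F (?\<gamma> s)) (at s)" for s by (simp add: if_distrib)
  moreover have "?\<gamma> 0 = z" using \<alpha>(1) by simp
  ultimately show ?thesis using that[of ?\<gamma>] by blast
qed

lemma gronwall_zero: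
  fixes f f' :: "real \<Rightarrow> real"
  assumes deriv: "\<And>s. (f has_real_derivative f' s) (at s)" and growth: "\<And>s. \<bar>f' s\<bar> \<le> K * f s"
    and nonneg: "\<And>s. 0 \<le> f s" and zero: "f 0 = 0"
  shows "f s = 0"
proof -
  have "f s * exp (- K * s) \<le> 0 \<or> f s * exp (K * s) \<le> 0"
  proof (cases "0 \<le> s")
    case True
    have "f s * exp (- K * s) \<le> f 0 * exp (- K * 0)"
    proof (rule DERIV_nonpos_imp_nonincreasing[OF True], intro exI conjI)
      fix t
      show "((\<lambda>t. f t * exp (- K * t)) has_real_derivative (f' t - K * f t) * exp (- K * t)) (at t)"
        by (auto intro!: derivative_eq_intros deriv simp: algebra_simps)
      show "(f' t - K * f t) * exp (- K * t) \<le> 0"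
        using growth[of t] by (intro mult_nonpos_nonneg) auto
    qed
    then show ?thesis using zero by simp
  next
    case False
    then have "s \<le> 0" by simp
    have "f s * exp (K * s) \<le> f 0 * exp (K * 0)"
    proof (rule DERIV_nonneg_imp_nondecreasing[OF \<open>s \<le> 0\<close>], intro exI conjI)
      fix t
      show "((\<lambda>t. f t * exp (K * t)) has_real_derivative (f' t + K * f t) * exp (K * t)) (at t)"
        by (auto intro!: derivative_eq_intros deriv simp: algebra_simps)
      show "0 \<le> (f' t + K * f t) * exp (K * t)"
        using growth[of t] by (intro mult_nonneg_nonneg) auto
    qed
    then show ?thesis using zero by simp
  qed
  then show ?thesis using nonneg[of s] by (auto simp: mult_le_0_iff)
qed

lemma lipschitz_ode_unique:
  fixes F :: "'a::real_inner \<Rightarrow> 'a"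
  assumes lipschitz: "L-lipschitz_on UNIV F"
    and \<gamma>: "\<And>s. (\<gamma> has_vector_derivative F (\<gamma> s)) (at s)"
    and \<delta>: "\<And>s. (\<delta> has_vector_derivative F (\<delta> s)) (at s)"
    and eq: "\<gamma> 0 = \<delta> 0"
  shows "\<gamma> = \<delta>"
proof
  fix s
  define d where "d s = (\<gamma> s - \<delta> s) \<bullet> (\<gamma> s - \<delta> s)" for s
  define d' where "d' s = 2 * ((F (\<gamma> s) - F (\<delta> s)) \<bullet> (\<gamma> s - \<delta> s))" for s
  have deriv: "(d has_real_derivative d' s) (at s)" for s
  proof -
    have "((\<lambda>s. \<gamma> s - \<delta> s) has_derivative (\<lambda>h. h *\<^sub>R (F (\<gamma> s) - F (\<delta> s)))) (at s)"
      using has_vector_derivative_diff[OF \<gamma> \<delta>] by (simp add: has_vector_derivative_def)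
    from has_derivative_inner[OF this this]
    show ?thesis
      unfolding d_def[abs_def] d'_def has_field_derivative_def
      by (rule has_derivative_eq_rhs) (auto simp: inner_commute algebra_simps fun_eq_iff)
  qed
  have growth: "\<bar>d' s\<bar> \<le> (2 * L) * d s" for s
  proof -
    have "\<bar>(F (\<gamma> s) - F (\<delta> s)) \<bullet> (\<gamma> s - \<delta> s)\<bar> \<le> norm (F (\<gamma> s) - F (\<delta> s)) * norm (\<gamma> s - \<delta> s)"
      by (rule Cauchy_Schwarz_ineq2)
    also have "\<dots> \<le> (L * norm (\<gamma> s - \<delta> s)) * norm (\<gamma> s - \<delta> s)"
      by (intro mult_right_mono lipschitz_on_normD[OF lipschitz]) auto
    finally show ?thesis
      by (simp add: d'_def d_def abs_mult power2_norm_eq_inner[symmetric] power2_eq_square)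
  qed
  have "d s = 0"
    by (rule gronwall_zero[OF deriv growth]) (simp_all add: d_def eq)
  then show "\<gamma> s = \<delta> s" by (simp add: d_def)
qed

lemma lipschitz_on_scaleR_bounded:
  fixes f :: "'a::metric_space \<Rightarrow> real" and g :: "'a \<Rightarrow> 'b::real_normed_vector"
  assumes f: "C-lipschitz_on S f" "\<And>x. x \<in> S \<Longrightarrow> \<bar>f x\<bar> \<le> A"
    and g: "D-lipschitz_on S g" "\<And>x. x \<in> S \<Longrightarrow> norm (g x) \<le> B" and "0 \<le> A" "0 \<le> B"
  shows "(C * B + A * D)-lipschitz_on S (\<lambda>x. f x *\<^sub>R g x)"
proof (rule lipschitz_onI)
  fix x y assume xy: "x \<in> S" "y \<in> S"
  have "f x *\<^sub>R g x - f y *\<^sub>R g y = (f x - f y) *\<^sub>R g x + f y *\<^sub>R (g x - g y)"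
    by (simp add: algebra_simps)
  then have "dist (f x *\<^sub>R g x) (f y *\<^sub>R g y) \<le> \<bar>f x - f y\<bar> * norm (g x) + \<bar>f y\<bar> * norm (g x - g y)"
    using norm_triangle_ineq[of "(f x - f y) *\<^sub>R g x" "f y *\<^sub>R (g x - g y)"]
    by (simp add: dist_norm)
  also have "\<dots> \<le> (C * dist x y) * B + A * (D * dist x y)"
    using lipschitz_onD[OF f(1) xy] lipschitz_onD[OF g(1) xy] f(2)[OF xy(2)] g(2)[OF xy(1)] assms(5)
      lipschitz_on_nonneg[OF f(1)]
    by (intro add_mono mult_mono) (auto simp: dist_norm)
  finally show "dist (f x *\<^sub>R g x) (f y *\<^sub>R g y) \<le> (C * B + A * D) * dist x y"
    by (simp add: algebra_simps)
qed (use assms(5,6) lipschitz_on_nonneg[OF f(1)] lipschitz_on_nonneg[OF g(1)] in auto)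

lemma conserved_along_orbit:
  fixes E :: "'a::real_normed_vector \<Rightarrow> 'b::real_normed_vector" and \<gamma> :: "real \<Rightarrow> 'a"
  assumes conserved: "\<And>w. (E has_derivative E' w) (at w)" "\<And>w. E' w (F w) = 0"
    and \<gamma>: "\<And>s. (\<gamma> has_vector_derivative r s *\<^sub>R F (\<gamma> s)) (at s)"
  shows "E (\<gamma> s) = E (\<gamma> 0)"
proof -
  have "((\<lambda>s. E (\<gamma> s)) has_derivative (\<lambda>h. 0)) (at s within UNIV)" for s
  proof -
    have "E' (\<gamma> s) (h *\<^sub>R r s *\<^sub>R F (\<gamma> s)) = 0" for h
      using linear_scale[OF has_derivative_linear[OF conserved(1)], of "\<gamma> s" "h * r s"] conserved(2)
      by simp
    then show ?thesis
      using has_derivative_compose[OF \<gamma>[of s, unfolded has_vector_derivative_def] conserved(1)]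
      by simp
  qed
  then show ?thesis by (metis convex_UNIV UNIV_I has_derivative_zero_unique)
qed

text \<open>Cutting the field off outside \<open>S\<close> makes it globally Lipschitz without spoiling the
  conservation of \<open>E\<close>, so the orbit stays on its level set and never sees the cutoff.\<close>

lemma conserved_energy_unique_orbit:
  fixes F :: "'a::euclidean_space \<Rightarrow> 'a" and E :: "'a \<Rightarrow> 'b::real_normed_vector" and \<kappa> :: "'a \<Rightarrow> real"
  assumes conserved: "\<And>w. (E has_derivative E' w) (at w)" "\<And>w. E' w (F w) = 0"
    and S: "convex S" "closed S" "z \<in> S"
    and F: "L-lipschitz_on S F" "\<And>w. w \<in> S \<Longrightarrow> norm (F w) \<le> B"
    and cutoff: "C-lipschitz_on UNIV \<kappa>" "\<And>w. \<bar>\<kappa> w\<bar> \<le> 1" "\<And>w. w \<notin> S \<Longrightarrow> \<kappa> w = 0"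
    and level: "\<And>w. E w = E z \<Longrightarrow> \<kappa> w = 1"
  shows "\<exists>!\<gamma>. (\<forall>s. (\<gamma> has_vector_derivative F (\<gamma> s)) (at s)) \<and> \<gamma> 0 = z"
proof -
  let ?F = "\<lambda>w. \<kappa> w *\<^sub>R F (closest_point S w)"
  have proj: "closest_point S w \<in> S" for w using S by (intro closest_point_in_set) auto
  have "1-lipschitz_on UNIV (closest_point S)"
    using closest_point_lipschitz[OF S(1,2)] S(3) by (intro lipschitz_onI) auto
  then have "(L * 1)-lipschitz_on UNIV (\<lambda>w. F (closest_point S w))"
    using F(1) proj by (intro lipschitz_on_compose2[where g = F]) (auto intro: lipschitz_on_subset)
  then have lip: "(C * B + 1 * (L * 1))-lipschitz_on UNIV ?F"
    using order_trans[OF norm_ge_zero F(2)[OF S(3)]]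
    by (intro lipschitz_on_scaleR_bounded cutoff(1,2) F(2) proj) auto
  have cut_field: "?F w = \<kappa> w *\<^sub>R F w" for w
    using cutoff(3)[of w] by (cases "w \<in> S") (simp_all add: closest_point_self)
  obtain \<gamma> where \<gamma>: "\<gamma> 0 = z" "\<And>s. (\<gamma> has_vector_derivative ?F (\<gamma> s)) (at s)"
    using lipschitz_ode_exists[OF lip] by blast
  have "?F (\<gamma> s) = F (\<gamma> s)" for s unfolding cut_field
    using conserved_along_orbit[OF conserved, of \<gamma> "\<lambda>s. \<kappa> (\<gamma> s)" s] level[of "\<gamma> s"] \<gamma>
    by (simp add: cut_field)
  with \<gamma> have "(\<forall>s. (\<gamma> has_vector_derivative F (\<gamma> s)) (at s)) \<and> \<gamma> 0 = z" by simp
  moreover have "\<delta> = \<gamma>" if \<delta>: "\<forall>s. (\<delta> has_vector_derivative F (\<delta> s)) (at s)" "\<delta> 0 = z" for \<delta>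
  proof (rule lipschitz_ode_unique[OF lip _ \<gamma>(2)])
    have "?F (\<delta> s) = F (\<delta> s)" for s unfolding cut_field
      using conserved_along_orbit[OF conserved, of \<delta> "\<lambda>_. 1" s] level[of "\<delta> s"] \<delta>
      by (simp add: cut_field)
    then show "(\<delta> has_vector_derivative ?F (\<delta> s)) (at s)" for s using \<delta>(1) by simp
  qed (simp add: \<delta>(2) \<gamma>(1))
  ultimately show ?thesis by blast
qed

section \<open>Exponential sums along windows\<close>

definition window_mean :: "real \<Rightarrow> real \<Rightarrow> complex" where
  "window_mean T a = (if a = 0 then 1 else (cis (a * T) - 1) / (\<i> * a * T))"

lemma has_integral_cis_window:
  assumes T: "0 < T"
  shows "((\<lambda>t. cis (a * (s + t))) has_integral T * (window_mean T a * cis (a * s))) {0..T}"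
proof (cases "a = 0")
  case True
  then show ?thesis
    using has_integral_const_real[of "1::complex" 0 T] T
    by (simp add: window_mean_def scaleR_conv_of_real)
next
  case False
  have "((\<lambda>t. cis (a * (s + t))) has_integral
      cis (a * (s + T)) / (\<i> * a) - cis (a * (s + 0)) / (\<i> * a)) {0..T}"
  proof (rule fundamental_theorem_of_calculus)
    fix t
    show "((\<lambda>t. cis (a * (s + t)) / (\<i> * a)) has_vector_derivative cis (a * (s + t)))
        (at t within {0..T})"
      using False unfolding has_vector_derivative_def
      by (auto intro!: derivative_eq_intros simp: fun_eq_iff scaleR_conv_of_real)
         (simp add: complex_eq_iff)
  qed (use T in auto)
  moreover have "cis (a * (s + T)) = cis (a * s) * cis (a * T)"
    by (simp add: cis_mult algebra_simps)
  ultimately show ?thesis using False T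
    by (simp add: window_mean_def diff_divide_distrib algebra_simps)
qed

lemma norm_window_mean_le:
  assumes "0 < T" "a \<noteq> 0"
  shows "norm (window_mean T a) \<le> 2 / (\<bar>a\<bar> * T)"
proof -
  have "norm (cis (a * T) - 1) \<le> 2"
    using norm_triangle_ineq4[of "cis (a * T)" 1] by simp
  then show ?thesis
    using assms by (simp add: window_mean_def norm_divide norm_mult divide_right_mono)
qed

lemma nonpos_exponential_sum_average:
  fixes c :: "'i \<Rightarrow> complex" and \<alpha> :: "'i \<Rightarrow> real"
  assumes fin: "finite I" and T: "0 < T"
    and nonpos: "\<And>t. t \<in> {0..T} \<Longrightarrow> Re (\<Sum>k\<in>I. c k * cis (\<alpha> k * (s + t))) \<le> 0"
  shows "Re (\<Sum>k\<in>I. c k * window_mean T (\<alpha> k) * cis (\<alpha> k * s)) \<le> 0"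
proof -
  have "((\<lambda>t. \<Sum>k\<in>I. c k * cis (\<alpha> k * (s + t))) has_integral
      (\<Sum>k\<in>I. c k * (T * (window_mean T (\<alpha> k) * cis (\<alpha> k * s))))) {0..T}"
    by (intro has_integral_sum has_integral_mult_right has_integral_cis_window fin T)
  then have "((\<lambda>t. Re (\<Sum>k\<in>I. c k * cis (\<alpha> k * (s + t)))) has_integral
      Re (\<Sum>k\<in>I. c k * (T * (window_mean T (\<alpha> k) * cis (\<alpha> k * s))))) {0..T}"
    by (rule has_integral_Re)
  then have "Re (\<Sum>k\<in>I. c k * (T * (window_mean T (\<alpha> k) * cis (\<alpha> k * s)))) \<le> 0"
    using nonpos by (rule has_integral_le[OF _ has_integral_0])
  moreover have "(\<Sum>k\<in>I. c k * (T * (window_mean T (\<alpha> k) * cis (\<alpha> k * s)))) =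
      T * (\<Sum>k\<in>I. c k * window_mean T (\<alpha> k) * cis (\<alpha> k * s))"
    by (simp add: sum_distrib_left mult_ac)
  ultimately show ?thesis using T by (simp add: mult_le_0_iff)
qed

text \<open>Averaging \<open>m\<close> times over windows of length \<open>T\<close> damps the coefficient of frequency \<open>\<alpha>\<close> by a
  factor of size at most \<open>(2 / (\<bar>\<alpha>\<bar> T))\<^sup>m\<close> and preserves nonpositivity.\<close>

lemma nonpos_exponential_sum_mean_le:
  fixes c :: "'i \<Rightarrow> complex" and \<alpha> :: "'i \<Rightarrow> real"
  assumes fin: "finite I" and T: "0 < T"
    and nonpos: "\<And>s. s \<in> {0..real m * T} \<Longrightarrow> Re (\<Sum>k\<in>I. c k * cis (\<alpha> k * s)) \<le> 0"
  shows "Re (\<Sum>k\<in>{k\<in>I. \<alpha> k = 0}. c k)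
    \<le> (\<Sum>k\<in>{k\<in>I. \<alpha> k \<noteq> 0}. norm (c k) * (2 / (\<bar>\<alpha> k\<bar> * T)) ^ m)"
  using nonpos
proof (induction m arbitrary: c)
  case 0
  let ?Z = "{k\<in>I. \<alpha> k = 0}" and ?N = "{k\<in>I. \<alpha> k \<noteq> 0}"
  have "(\<Sum>k\<in>I. c k) = (\<Sum>k\<in>?Z. c k) + (\<Sum>k\<in>?N. c k)"
    using fin by (subst sum.union_disjoint[symmetric]) (auto intro!: sum.cong)
  then have "Re (\<Sum>k\<in>?Z. c k) \<le> - Re (\<Sum>k\<in>?N. c k)" using "0.prems"[of 0] by simp
  also have "\<dots> \<le> norm (\<Sum>k\<in>?N. c k)" using abs_Re_le_cmod abs_le_D2 by blast
  also have "\<dots> \<le> (\<Sum>k\<in>?N. norm (c k))" by (rule norm_sum)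
  finally show ?case by simp
next
  case (Suc m)
  let ?c = "\<lambda>k. c k * window_mean T (\<alpha> k)"
  have "Re (\<Sum>k\<in>I. ?c k * cis (\<alpha> k * s)) \<le> 0" if "s \<in> {0..real m * T}" for s
    using that T by (intro nonpos_exponential_sum_average fin Suc.prems) (auto simp: algebra_simps)
  then have "Re (\<Sum>k\<in>{k\<in>I. \<alpha> k = 0}. ?c k)
    \<le> (\<Sum>k\<in>{k\<in>I. \<alpha> k \<noteq> 0}. norm (?c k) * (2 / (\<bar>\<alpha> k\<bar> * T)) ^ m)"
    by (rule Suc.IH)
  also have "(\<Sum>k\<in>{k\<in>I. \<alpha> k = 0}. ?c k) = (\<Sum>k\<in>{k\<in>I. \<alpha> k = 0}. c k)"
    by (intro sum.cong) (auto simp: window_mean_def)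
  also have "norm (?c k) * (2 / (\<bar>\<alpha> k\<bar> * T)) ^ m \<le> norm (c k) * (2 / (\<bar>\<alpha> k\<bar> * T)) ^ Suc m"
    if "\<alpha> k \<noteq> 0" for k
  proof -
    have "norm (c k) * norm (window_mean T (\<alpha> k)) * (2 / (\<bar>\<alpha> k\<bar> * T)) ^ m
      \<le> norm (c k) * (2 / (\<bar>\<alpha> k\<bar> * T)) * (2 / (\<bar>\<alpha> k\<bar> * T)) ^ m"
      using T norm_window_mean_le[OF T that] by (intro mult_right_mono mult_left_mono) auto
    then show ?thesis by (simp add: norm_mult mult_ac)
  qed
  then have "(\<Sum>k\<in>{k\<in>I. \<alpha> k \<noteq> 0}. norm (?c k) * (2 / (\<bar>\<alpha> k\<bar> * T)) ^ m)
    \<le> (\<Sum>k\<in>{k\<in>I. \<alpha> k \<noteq> 0}. norm (c k) * (2 / (\<bar>\<alpha> k\<bar> * T)) ^ Suc m)"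
    by (intro sum_mono) auto
  finally show ?case .
qed

section \<open>A trigonometric kernel localised near the integers\<close>

definition trig_sum :: "nat \<Rightarrow> (int \<Rightarrow> real) \<Rightarrow> real \<Rightarrow> complex" where
  "trig_sum N c t = (\<Sum>d\<in>{- int N..int N}. of_real (c d) * cis (2 * pi * of_int d * t))"

lemma trig_sum_shift:
  fixes c :: "int \<Rightarrow> real"
  assumes c: "\<And>d. int N \<le> \<bar>d\<bar> \<Longrightarrow> c d = 0" and k: "\<bar>k\<bar> \<le> 1"
  shows "trig_sum N (\<lambda>d. c (d - k)) t = cis (2 * pi * of_int k * t) * trig_sum N c t"
  unfolding trig_sum_def sum_distrib_left
proof (rule sum.reindex_bij_witness_not_neutral[where i = "\<lambda>d. d + k" and j = "\<lambda>d. d - k"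
      and S' = "{- int N..int N} \<inter> {d. c (d - k) = 0}" and T' = "{- int N..int N} \<inter> {d. c d = 0}"])
  show "d - k \<in> {- int N..int N} - {- int N..int N} \<inter> {d. c d = 0}"
    if "d \<in> {- int N..int N} - {- int N..int N} \<inter> {d. c (d - k) = 0}" for d
    using that c[of "d - k"] by (cases "int N \<le> \<bar>d - k\<bar>") auto
  show "d + k \<in> {- int N..int N} - {- int N..int N} \<inter> {d. c (d - k) = 0}"
    if "d \<in> {- int N..int N} - {- int N..int N} \<inter> {d. c d = 0}" for d
    using that c[of d] k by (cases "int N \<le> \<bar>d\<bar>") auto
  show "cis (2 * pi * of_int k * t) * (of_real (c (d - k)) * cis (2 * pi * of_int (d - k) * t)) =
      of_real (c (d - k)) * cis (2 * pi * of_int d * t)" for d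
    by (simp add: cis_mult algebra_simps)
qed auto

lemma trig_sum_times_cos:
  fixes c :: "int \<Rightarrow> real" and e t :: real
  assumes "\<And>d. int N \<le> \<bar>d\<bar> \<Longrightarrow> c d = 0"
  shows "trig_sum N c t * of_real (e + cos (2 * pi * t)) =
    trig_sum N (\<lambda>d. e * c d + (c (d - 1) + c (d + 1)) / 2) t"
proof -
  have shift: "trig_sum N (\<lambda>d. c (d - k)) t = cis (2 * pi * of_int k * t) * trig_sum N c t"
    if "\<bar>k\<bar> \<le> 1" for k
    using assms that by (rule trig_sum_shift)
  have "trig_sum N (\<lambda>d. e * c d + (c (d - 1) + c (d + 1)) / 2) t =
      e * trig_sum N c t + (trig_sum N (\<lambda>d. c (d - 1)) t + trig_sum N (\<lambda>d. c (d - - 1)) t) / 2"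
    by (simp add: trig_sum_def sum_distrib_left sum_divide_distrib sum.distrib[symmetric]
        add_divide_distrib algebra_simps)
  also have "\<dots> = e * trig_sum N c t + (cis (2 * pi * t) + cis (- (2 * pi * t))) * trig_sum N c t / 2"
    using shift[of 1] shift[of "- 1"] by (simp add: algebra_simps)
  also have "cis (2 * pi * t) + cis (- (2 * pi * t)) = 2 * of_real (cos (2 * pi * t))"
    by (simp add: complex_eq_iff)
  finally show ?thesis by (simp add: algebra_simps)
qed

definition autocorrelation :: "nat \<Rightarrow> (int \<Rightarrow> real) \<Rightarrow> int \<Rightarrow> real" where
  "autocorrelation N w d = (\<Sum>j\<in>{0<..<int N}. w j * w (j + d))"

context
  fixes N :: nat and w :: "int \<Rightarrow> real"
  assumes support: "\<And>j. j \<notin> {0<..<int N} \<Longrightarrow> w j = 0"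
begin

lemma autocorrelation_eq_0:
  assumes "int N \<le> \<bar>d\<bar>"
  shows "autocorrelation N w d = 0"
proof -
  have "w (j + d) = 0" if "j \<in> {0<..<int N}" for j using that assms by (intro support) auto
  then show ?thesis by (simp add: autocorrelation_def)
qed

lemma norm_square_eq_trig_sum_autocorrelation:
  "complex_of_real ((norm (\<Sum>j\<in>{0<..<int N}. w j * cis (2 * pi * j * t)))\<^sup>2) =
    trig_sum N (autocorrelation N w) t"
proof -
  let ?J = "{0<..<int N}"
  have product: "(w l * cis (2 * pi * l * t)) * cnj (w j * cis (2 * pi * j * t)) =
      of_real (w j * w l) * cis (2 * pi * of_int (l - j) * t)" for j l
    by (simp add: cis_cnj cis_mult algebra_simps)
  have row: "(\<Sum>l\<in>?J. of_real (w j * w l) * cis (2 * pi * of_int (l - j) * t)) =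
      (\<Sum>d\<in>{- int N..int N}. of_real (w j * w (j + d)) * cis (2 * pi * of_int d * t))"
    if "j \<in> ?J" for j
  proof (rule sum.reindex_bij_witness_not_neutral[where i = "\<lambda>d. j + d" and j = "\<lambda>l. l - j"
        and S' = "{}" and T' = "{- int N..int N} \<inter> {d. j + d \<notin> ?J}"])
    show "l - j \<in> {- int N..int N} - {- int N..int N} \<inter> {d. j + d \<notin> ?J}" if "l \<in> ?J - {}" for l
      using that \<open>j \<in> ?J\<close> by auto
  qed (auto simp: support)
  have "complex_of_real ((norm (\<Sum>j\<in>?J. w j * cis (2 * pi * j * t)))\<^sup>2) =
      (\<Sum>j\<in>?J. \<Sum>l\<in>?J. of_real (w j * w l) * cis (2 * pi * of_int (l - j) * t))"
    unfolding complex_norm_square cnj_sum sum_product product by (rule sum.swap)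
  also have "\<dots> = (\<Sum>j\<in>?J. \<Sum>d\<in>{- int N..int N}.
      of_real (w j * w (j + d)) * cis (2 * pi * of_int d * t))"
    by (intro sum.cong row refl)
  also have "\<dots> = trig_sum N (autocorrelation N w) t"
    unfolding trig_sum_def autocorrelation_def of_real_sum sum_distrib_right by (rule sum.swap)
  finally show ?thesis .
qed

lemma abs_autocorrelation_le: "\<bar>autocorrelation N w d\<bar> \<le> autocorrelation N w 0"
proof -
  let ?J = "{0<..<int N}"
  have "\<bar>w j * w (j + d)\<bar> \<le> ((w j)\<^sup>2 + (w (j + d))\<^sup>2) / 2" for j
    using sum_squares_bound[of "\<bar>w j\<bar>" "\<bar>w (j + d)\<bar>"] by (simp add: abs_mult)
  then have "\<bar>autocorrelation N w d\<bar> \<le> (\<Sum>j\<in>?J. ((w j)\<^sup>2 + (w (j + d))\<^sup>2) / 2)"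
    unfolding autocorrelation_def by (intro order_trans[OF sum_abs] sum_mono)
  also have "\<dots> = ((\<Sum>j\<in>?J. (w j)\<^sup>2) + (\<Sum>j\<in>?J. (w (j + d))\<^sup>2)) / 2"
    by (simp add: sum.distrib sum_divide_distrib[symmetric])
  also have "(\<Sum>j\<in>?J. (w (j + d))\<^sup>2) = (\<Sum>l\<in>(\<lambda>j. j + d) ` ?J. (w l)\<^sup>2)"
    by (simp add: sum.reindex inj_on_def)
  also have "\<dots> = (\<Sum>l\<in>(\<lambda>j. j + d) ` ?J \<inter> ?J. (w l)\<^sup>2)"
    by (intro sum.mono_neutral_right) (auto simp: support)
  also have "\<dots> \<le> (\<Sum>l\<in>?J. (w l)\<^sup>2)" by (intro sum_mono2) auto
  finally show ?thesis by (simp add: autocorrelation_def power2_eq_square)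
qed

end

lemma one_minus_cos_le:
  fixes x :: real
  shows "1 - cos x \<le> x\<^sup>2 / 2"
proof -
  have "(sin (x/2))\<^sup>2 \<le> (x/2)\<^sup>2"
    using abs_sin_x_le_abs_x[of "x/2"] by (simp only: abs_le_square_iff)
  then show ?thesis using cos_double_sin[of "x/2"] by (simp add: power2_eq_square)
qed

lemma one_minus_cos_ge:
  fixes r :: real
  assumes "\<bar>r\<bar> \<le> 1/2"
  shows "8 * r\<^sup>2 \<le> 1 - cos (2 * pi * r)"
proof -
  have concave: "convex_on {0..pi} (\<lambda>x. - sin x)"
    by (rule f''_ge0_imp_convex[where f' = "\<lambda>x. - cos x" and f'' = sin])
       (auto intro!: derivative_eq_intros sin_ge_zero)
  have jordan: "2 * t \<le> sin (pi * t)" if "0 \<le> t" "t \<le> 1/2" for t :: real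
    using convex_onD[OF concave, of "2*t" 0 "pi/2"] that by (simp add: algebra_simps)
  have "\<bar>2 * r\<bar> \<le> \<bar>sin (pi * r)\<bar>"
    using jordan[of "\<bar>r\<bar>"] assms by (cases "r \<ge> 0") auto
  then have "4 * r\<^sup>2 \<le> (sin (pi * r))\<^sup>2" by (simp add: abs_le_square_iff power_mult_distrib)
  then show ?thesis using cos_double_sin[of "pi * r"] by (simp add: mult.assoc)
qed

lemma dirichlet_eigenvector:
  assumes N: "N \<ge> 2"
  obtains w :: "int \<Rightarrow> real" where "\<And>j. j \<notin> {0<..<int N} \<Longrightarrow> w j = 0" "(\<Sum>j\<in>{0<..<int N}. (w j)\<^sup>2) = 1"
    "\<And>j. j \<in> {0<..<int N} \<Longrightarrow> w (j + 1) + w (j - 1) = 2 * cos (pi / N) * w j"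
proof -
  let ?J = "{0<..<int N}"
  define S where "S = (\<Sum>j\<in>?J. (sin (pi * j / N))\<^sup>2)"
  define w where "w j = (if j \<in> ?J then sin (pi * j / N) / sqrt S else 0)" for j :: int
  have "0 < (sin (pi * (1::int) / N))\<^sup>2"
    using N by (intro zero_less_power sin_gt_zero) (auto simp: field_simps)
  also have "\<dots> \<le> S" unfolding S_def by (rule member_le_sum) (use N in auto)
  finally have S: "0 < S" .
  show ?thesis
  proof
    show "w j = 0" if "j \<notin> ?J" for j
      using that unfolding w_def by (rule if_not_P)
    show "(\<Sum>j\<in>?J. (w j)\<^sup>2) = 1"
      using S by (simp add: w_def S_def[symmetric] sum_divide_distrib[symmetric] power_divide)
    fix j assume j: "j \<in> ?J"
    have w: "w i = sin (pi * i / N) / sqrt S" if "0 \<le> i" "i \<le> int N" for i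
      using that N by (cases "i = 0 \<or> i = int N") (auto simp: w_def)
    have "w (j + 1) + w (j - 1) = (sin (pi * j / N + pi / N) + sin (pi * j / N - pi / N)) / sqrt S"
      using j by (simp add: w algebra_simps add_divide_distrib diff_divide_distrib)
    also have "\<dots> = 2 * cos (pi / N) * w j"
      using j by (simp add: w sin_add sin_diff)
    finally show "w (j + 1) + w (j - 1) = 2 * cos (pi / N) * w j" .
  qed
qed

text \<open>The first Dirichlet eigenvector of the path of length \<open>N\<close> maximises \<open>a 1 + a (-1)\<close> among
  autocorrelations \<open>a\<close> with \<open>a 0 = 1\<close>: this makes the kernel concentrate at scale \<open>1/N\<close>.\<close>

lemma localised_kernel:
  assumes N: "N \<ge> 2"
  obtains k :: "real \<Rightarrow> real" and a :: "int \<Rightarrow> real" where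
    "\<And>t. 0 \<le> k t" "\<And>t. complex_of_real (k t) = trig_sum N a t"
    "\<And>d. \<bar>a d\<bar> \<le> 1" "\<And>d. int N \<le> \<bar>d\<bar> \<Longrightarrow> a d = 0"
    "a 0 = 1" "a 1 + a (- 1) = 2 * cos (pi / N)"
proof -
  let ?J = "{0<..<int N}"
  obtain w :: "int \<Rightarrow> real" where support: "\<And>j. j \<notin> ?J \<Longrightarrow> w j = 0" and unit: "(\<Sum>j\<in>?J. (w j)\<^sup>2) = 1"
    and eigenvector: "\<And>j. j \<in> ?J \<Longrightarrow> w (j + 1) + w (j - 1) = 2 * cos (pi / N) * w j"
    using dirichlet_eigenvector[OF N] by blast
  have zero: "autocorrelation N w 0 = 1"
    using unit by (simp add: autocorrelation_def flip: power2_eq_square)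
  show ?thesis
  proof
    show "complex_of_real ((norm (\<Sum>j\<in>?J. w j * cis (2 * pi * j * t)))\<^sup>2) =
        trig_sum N (autocorrelation N w) t" for t
      by (rule norm_square_eq_trig_sum_autocorrelation[of N w, OF support])
    show "\<bar>autocorrelation N w d\<bar> \<le> 1" for d
      using abs_autocorrelation_le[of N w d, OF support] zero by simp
    show "autocorrelation N w d = 0" if "int N \<le> \<bar>d\<bar>" for d
      by (rule autocorrelation_eq_0[of N w, OF support]) (use that in auto)
    have "autocorrelation N w 1 + autocorrelation N w (- 1) = (\<Sum>j\<in>?J. w j * (w (j + 1) + w (j - 1)))"
      by (simp add: autocorrelation_def sum.distrib[symmetric] distrib_left)
    also have "\<dots> = 2 * cos (pi / N) * autocorrelation N w 0"
      unfolding autocorrelation_def sum_distrib_left by (intro sum.cong) (auto simp: eigenvector)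
    finally show "autocorrelation N w 1 + autocorrelation N w (- 1) = 2 * cos (pi / N)"
      by (simp add: zero)
  qed (auto simp: zero)
qed

text \<open>The weight \<open>9/N\<^sup>2 - 1 + cos (2\<pi>t)\<close> is positive only at distance \<open>O(1/N)\<close> from the
  integers, yet the weighted kernel still has positive mean.\<close>

lemma localised_kernel_pair:
  assumes N: "N \<ge> 2"
  obtains k :: "real \<Rightarrow> real" and a b :: "int \<Rightarrow> real" where
    "\<And>t. 0 \<le> k t" "\<And>t. complex_of_real (k t) = trig_sum N a t"
    "\<And>t. complex_of_real (k t * (9 / real N ^ 2 - 1 + cos (2 * pi * t))) = trig_sum N b t"
    "\<And>d. \<bar>a d\<bar> \<le> 3" "\<And>d. \<bar>b d\<bar> \<le> 3" "a 0 = 1" "1 / real N ^ 2 \<le> b 0"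
proof -
  obtain k a where k: "\<And>t. 0 \<le> k t" "\<And>t. complex_of_real (k t) = trig_sum N a t"
    and a: "\<And>d. \<bar>a d\<bar> \<le> 1" "\<And>d. int N \<le> \<bar>d\<bar> \<Longrightarrow> a d = 0" "a 0 = 1" "a 1 + a (- 1) = 2 * cos (pi / N)"
    using localised_kernel[OF N] by metis
  define e where "e = 9 / real N ^ 2 - 1"
  define b where "b d = e * a d + (a (d - 1) + a (d + 1)) / 2" for d
  have "(2::real) ^ 2 \<le> real N ^ 2" using N by (intro power_mono) auto
  then have "9 / real N ^ 2 \<le> 9 / 4" using N by (intro divide_left_mono) auto
  moreover have "(0::real) \<le> 9 / real N ^ 2" by simp
  ultimately have e: "\<bar>e\<bar> \<le> 2" unfolding e_def by linarith
  have b: "\<bar>b d\<bar> \<le> 3" for d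
  proof -
    have "\<bar>e * a d\<bar> \<le> 2 * 1" unfolding abs_mult using e a(1) by (intro mult_mono) auto
    then show ?thesis using a(1)[of "d - 1"] a(1)[of "d + 1"]
      unfolding b_def add_divide_distrib by linarith
  qed
  have "1 - cos (pi / N) \<le> (pi / N)\<^sup>2 / 2" by (rule one_minus_cos_le)
  also have "\<dots> \<le> (4 / N)\<^sup>2 / 2" using pi_less_4 by (intro divide_right_mono power_mono) auto
  finally have b0: "1 / real N ^ 2 \<le> b 0" using a(3,4)
    by (simp add: b_def e_def power_divide add.commute)
  have "complex_of_real (k t * (e + cos (2 * pi * t))) = trig_sum N b t" for t
    using trig_sum_times_cos[of N a t e] a(2) by (simp add: b_def[abs_def] k(2))
  then show ?thesis
    using k a(3) b b0 order_trans[OF a(1), of 3] by (intro that[of k a b]) (auto simp: e_def)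
qed

section \<open>Density of Diophantine linear orbits\<close>

definition lattice_vec :: "('n::finite \<Rightarrow> int) \<Rightarrow> real^'n" where
  "lattice_vec D = (\<chi> j. of_int (D j))"

definition freq_box :: "nat \<Rightarrow> ('n::finite \<Rightarrow> int) set" where
  "freq_box N = PiE UNIV (\<lambda>_. {- int N..int N})"

lemma int_vec_lattice_vec: "int_vec (lattice_vec D)"
  by (simp add: int_vec_def lattice_vec_def)

lemma finite_freq_box: "finite (freq_box N)"
  by (simp add: freq_box_def finite_PiE)

lemma card_freq_box: "card (freq_box N :: ('n::finite \<Rightarrow> int) set) = (2 * N + 1) ^ CARD('n)"
  by (simp add: freq_box_def card_PiE nat_mult_distrib nat_add_distrib)

lemma trig_sum_prod:
  fixes x :: "real^'n"
  shows "(\<Prod>j\<in>UNIV. trig_sum N (c j) (x $ j)) =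
    (\<Sum>D\<in>freq_box N. of_real (\<Prod>j\<in>UNIV. c j (D j)) * cis (2 * pi * (lattice_vec D \<bullet> x)))"
proof -
  have "(\<Prod>j\<in>UNIV. of_real (c j (D j)) * cis (2 * pi * of_int (D j) * x $ j)) =
      of_real (\<Prod>j\<in>UNIV. c j (D j)) * cis (2 * pi * (lattice_vec D \<bullet> x))" for D
    by (simp add: prod.distrib cis_conv_exp exp_sum[symmetric] inner_vec_def lattice_vec_def
        sum_distrib_left mult_ac)
  then show ?thesis unfolding trig_sum_def freq_box_def by (subst prod_sum_PiE) auto
qed

lemma localising_trig_poly:
  assumes N: "N \<ge> 2"
  obtains P :: "real^'n \<Rightarrow> real" and A :: "('n \<Rightarrow> int) \<Rightarrow> real" where
    "\<And>x. complex_of_real (P x) = (\<Sum>D\<in>freq_box N. A D * cis (2 * pi * (lattice_vec D \<bullet> x)))"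
    "\<And>D. \<bar>A D\<bar> \<le> real CARD('n) * 3 ^ CARD('n)" "real CARD('n) / real N ^ 2 \<le> A (\<lambda>_. 0)"
    "\<And>x. 0 < P x \<Longrightarrow> (\<Sum>i\<in>UNIV. 1 - cos (2 * pi * x $ i)) < 9 * real CARD('n) / real N ^ 2"
proof -
  let ?e = "\<lambda>t. 9 / real N ^ 2 - 1 + cos (2 * pi * t)"
  obtain k a b where k: "\<And>t. 0 \<le> k t" "\<And>t. complex_of_real (k t) = trig_sum N a t"
      "\<And>t. complex_of_real (k t * ?e t) = trig_sum N b t"
    and coeffs: "\<And>d. \<bar>a d\<bar> \<le> 3" "\<And>d. \<bar>b d\<bar> \<le> 3" "a 0 = 1" "1 / real N ^ 2 \<le> b 0"
    using localised_kernel_pair[OF N] by metis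
  define c where "c i j = (if j = i then b else a)" for i j :: 'n
  define A where "A D = (\<Sum>i\<in>UNIV. \<Prod>j\<in>UNIV. c i j (D j))" for D
  define P where "P x = (\<Prod>j\<in>UNIV. k (x $ j)) * (\<Sum>i\<in>UNIV. ?e (x $ i))" for x :: "real^'n"
  show ?thesis
  proof
    fix x :: "real^'n" and D :: "'n \<Rightarrow> int"
    have "trig_sum N (c i j) (x $ j) = of_real (k (x $ j) * (if j = i then ?e (x $ i) else 1))"
      for i j
      by (simp add: c_def flip: k(2,3))
    then have "(\<Prod>j\<in>UNIV. trig_sum N (c i j) (x $ j)) =
        of_real ((\<Prod>j\<in>UNIV. k (x $ j)) * ?e (x $ i))" for i
      by (simp only: of_real_prod[symmetric] prod.distrib prod.delta finite UNIV_I if_True)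
    then have "complex_of_real (P x) = (\<Sum>i\<in>UNIV. \<Prod>j\<in>UNIV. trig_sum N (c i j) (x $ j))"
      by (simp only: P_def sum_distrib_left of_real_sum)
    also have "\<dots> = (\<Sum>D\<in>freq_box N. A D * cis (2 * pi * (lattice_vec D \<bullet> x)))"
      unfolding trig_sum_prod A_def of_real_sum sum_distrib_right by (rule sum.swap)
    finally show "complex_of_real (P x) = (\<Sum>D\<in>freq_box N. A D * cis (2 * pi * (lattice_vec D \<bullet> x)))" .
    have "\<bar>c i j d\<bar> \<le> 3" for i j d using coeffs by (simp add: c_def)
    then have "\<bar>\<Prod>j\<in>UNIV. c i j (D j)\<bar> \<le> (\<Prod>j\<in>(UNIV::'n set). 3)" for i
      unfolding abs_prod by (intro prod_mono) auto
    then have "\<bar>A D\<bar> \<le> (\<Sum>i\<in>(UNIV::'n set). \<Prod>j\<in>(UNIV::'n set). 3)"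
      unfolding A_def by (intro order_trans[OF sum_abs] sum_mono)
    then show "\<bar>A D\<bar> \<le> real CARD('n) * 3 ^ CARD('n)" by simp
    have "c i j 0 = (if j = i then b 0 else 1)" for i j by (simp add: c_def coeffs)
    then have "A (\<lambda>_. 0) = real CARD('n) * b 0" by (simp add: A_def prod.delta)
    then show "real CARD('n) / real N ^ 2 \<le> A (\<lambda>_. 0)"
      using mult_left_mono[OF coeffs(4), of "real CARD('n)"] by simp
    assume "0 < P x"
    then have "0 < (\<Sum>i\<in>UNIV. ?e (x $ i))"
      using prod_nonneg[of UNIV "\<lambda>j. k (x $ j)"] k(1) by (auto simp: P_def zero_less_mult_iff)
    then show "(\<Sum>i\<in>UNIV. 1 - cos (2 * pi * x $ i)) < 9 * real CARD('n) / real N ^ 2"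
      by (simp add: sum.distrib sum_subtractf algebra_simps)
  qed
qed

lemma lattice_distance_le_cos_sum:
  fixes x :: "real^'n"
  obtains z where "int_vec z" "8 * (norm (x - z))\<^sup>2 \<le> (\<Sum>i\<in>UNIV. 1 - cos (2 * pi * x $ i))"
proof
  let ?z = "\<lambda>i. round (x $ i)"
  have "8 * (x $ i - ?z i)\<^sup>2 \<le> 1 - cos (2 * pi * x $ i)" for i
  proof -
    have "\<bar>x $ i - ?z i\<bar> \<le> 1/2" using of_int_round_abs_le[of "x $ i"]
      by (simp add: abs_minus_commute)
    then have "8 * (x $ i - ?z i)\<^sup>2 \<le> 1 - cos (2 * pi * (x $ i - ?z i))" by (rule one_minus_cos_ge)
    also have "cos (2 * pi * (x $ i - ?z i)) = cos (2 * pi * x $ i)"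
      by (simp add: right_diff_distrib cos_diff)
    finally show ?thesis .
  qed
  then show "8 * (norm (x - lattice_vec ?z))\<^sup>2 \<le> (\<Sum>i\<in>UNIV. 1 - cos (2 * pi * x $ i))"
    by (simp add: power2_norm_eq_inner inner_vec_def lattice_vec_def sum_distrib_left sum_mono
        flip: power2_eq_square)
qed (rule int_vec_lattice_vec)

lemma diophantine_exponent_pos:
  fixes \<omega> :: "real^'n"
  assumes "diophantine \<nu> \<eta> \<omega>"
  shows "0 < \<eta>"
proof -
  have "1 \<le> CARD('n)" by (simp add: Suc_leI)
  then show ?thesis using assms unfolding diophantine_def by linarith
qed

lemma diophantine_small_divisor:
  fixes \<omega> :: "real^'n"
  assumes dio: "diophantine \<nu> \<eta> \<omega>" and D: "D \<in> freq_box N" "D \<noteq> (\<lambda>_. 0)"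
  shows "lattice_vec D \<bullet> \<omega> \<noteq> 0"
    and "1 / \<bar>lattice_vec D \<bullet> \<omega>\<bar> \<le> (real CARD('n) * real N) powr \<eta> / \<nu>"
proof -
  let ?l1 = "\<Sum>i\<in>UNIV. \<bar>lattice_vec D $ i\<bar>"
  have \<nu>: "0 < \<nu>" using dio by (simp add: diophantine_def)
  obtain i where "D i \<noteq> 0" using D(2) by auto
  then have "0 < \<bar>lattice_vec D $ i\<bar>" by (simp add: lattice_vec_def)
  also have "\<dots> \<le> ?l1" by (rule member_le_sum) auto
  finally have l1: "0 < ?l1" .
  then have "lattice_vec D \<noteq> 0" by auto
  then have lower: "\<nu> * ?l1 powr (- \<eta>) \<le> \<bar>lattice_vec D \<bullet> \<omega>\<bar>"
    using dio int_vec_lattice_vec[of D] unfolding diophantine_def by (metis inner_commute)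
  have pos: "0 < \<nu> * ?l1 powr (- \<eta>)" using \<nu> l1 by simp
  then show "lattice_vec D \<bullet> \<omega> \<noteq> 0" using lower by auto
  have "\<bar>lattice_vec D $ i\<bar> \<le> real N" for i
  proof -
    have "D i \<in> {- int N..int N}" using D(1) by (auto simp: freq_box_def PiE_def)
    then have "\<bar>D i\<bar> \<le> int N" by auto
    then show ?thesis by (simp add: lattice_vec_def)
  qed
  then have "?l1 \<le> (\<Sum>i\<in>(UNIV::'n set). real N)" by (rule sum_mono)
  then have "?l1 powr \<eta> \<le> (real CARD('n) * real N) powr \<eta>"
    using l1 diophantine_exponent_pos[OF dio] by (intro powr_mono2) auto
  then have "?l1 powr \<eta> / \<nu> \<le> (real CARD('n) * real N) powr \<eta> / \<nu>"
    using \<nu> by (intro divide_right_mono) auto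
  moreover have "1 / \<bar>lattice_vec D \<bullet> \<omega>\<bar> \<le> 1 / (\<nu> * ?l1 powr (- \<eta>))"
    using lower pos by (intro frac_le) auto
  moreover have "1 / (\<nu> * ?l1 powr (- \<eta>)) = ?l1 powr \<eta> / \<nu>" by (simp add: powr_minus field_simps)
  ultimately show "1 / \<bar>lattice_vec D \<bullet> \<omega>\<bar> \<le> (real CARD('n) * real N) powr \<eta> / \<nu>" by linarith
qed

lemma trig_poly_positive_on_diophantine_orbit:
  fixes \<omega> x :: "real^'n" and P :: "real^'n \<Rightarrow> real" and A :: "('n \<Rightarrow> int) \<Rightarrow> real"
  assumes dio: "diophantine \<nu> \<eta> \<omega>" and T: "0 < T"
    and P: "\<And>x. complex_of_real (P x) = (\<Sum>D\<in>freq_box N. A D * cis (2 * pi * (lattice_vec D \<bullet> x)))"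
    and A: "\<And>D. \<bar>A D\<bar> \<le> M"
    and mean: "(2 * real N + 1) ^ CARD('n) *
      (M * ((real CARD('n) * real N) powr \<eta> / (pi * \<nu> * T)) ^ m) < A (\<lambda>_. 0)"
  shows "\<exists>s\<in>{0..real m * T}. 0 < P (x + s *\<^sub>R \<omega>)"
proof (rule ccontr)
  assume nonpos: "\<not> ?thesis"
  define \<alpha> where "\<alpha> D = 2 * pi * (lattice_vec D \<bullet> \<omega>)" for D :: "'n \<Rightarrow> int"
  define c where "c D = A D * cis (2 * pi * (lattice_vec D \<bullet> x))" for D
  define \<rho> where "\<rho> = (real CARD('n) * real N) powr \<eta> / (pi * \<nu> * T)"
  have \<rho>: "0 \<le> \<rho>" using dio T by (simp add: \<rho>_def diophantine_def)
  have M: "0 \<le> M" using A[of undefined] by simp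
  have damping: "2 / (\<bar>\<alpha> D\<bar> * T) \<le> \<rho>" if "D \<in> freq_box N" "D \<noteq> (\<lambda>_. 0)" for D
    using divide_right_mono[OF diophantine_small_divisor(2)[OF dio that], of "pi * T"] T
    by (simp add: \<alpha>_def \<rho>_def abs_mult mult_ac)
  have zero: "(\<lambda>_. 0) \<in> freq_box N" "\<alpha> (\<lambda>_. 0) = 0"
    by (auto simp: freq_box_def PiE_def \<alpha>_def lattice_vec_def inner_vec_def)
  have "Re (\<Sum>D\<in>freq_box N. c D * cis (\<alpha> D * s)) \<le> 0" if "s \<in> {0..real m * T}" for s
  proof -
    have "(\<Sum>D\<in>freq_box N. c D * cis (\<alpha> D * s)) = complex_of_real (P (x + s *\<^sub>R \<omega>))"
      unfolding P
      by (intro sum.cong) (auto simp: c_def \<alpha>_def cis_mult inner_add_right algebra_simps)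
    then show ?thesis using nonpos that by force
  qed
  then have "Re (\<Sum>D\<in>{D\<in>freq_box N. \<alpha> D = 0}. c D)
      \<le> (\<Sum>D\<in>{D\<in>freq_box N. \<alpha> D \<noteq> 0}. norm (c D) * (2 / (\<bar>\<alpha> D\<bar> * T)) ^ m)"
    by (rule nonpos_exponential_sum_mean_le[OF finite_freq_box T])
  also have "{D\<in>freq_box N. \<alpha> D = 0} = {\<lambda>_. 0}"
    using diophantine_small_divisor(1)[OF dio] zero by (auto simp: \<alpha>_def)
  also have "Re (\<Sum>D\<in>{\<lambda>_. 0}. c D) = A (\<lambda>_. 0)"
    by (simp add: c_def lattice_vec_def inner_vec_def)
  also have "(\<Sum>D\<in>{D\<in>freq_box N. \<alpha> D \<noteq> 0}. norm (c D) * (2 / (\<bar>\<alpha> D\<bar> * T)) ^ m)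
      \<le> (\<Sum>D\<in>{D\<in>freq_box N. \<alpha> D \<noteq> 0}. M * \<rho> ^ m)"
    using damping zero(2) A M T
    by (intro sum_mono mult_mono power_mono) (auto simp: c_def norm_mult)
  also have "\<dots> \<le> (\<Sum>D\<in>(freq_box N :: ('n \<Rightarrow> int) set). M * \<rho> ^ m)"
    using finite_freq_box M \<rho> by (intro sum_mono2) auto
  also have "\<dots> = (2 * real N + 1) ^ CARD('n) * (M * \<rho> ^ m)" by (simp add: card_freq_box add.commute)
  finally show False using mean by (simp add: \<rho>_def)
qed

lemma damped_coefficient_sum_less:
  fixes N n m :: nat and \<eta> :: real
  assumes N: "N \<ge> 1" and n: "n \<ge> 1" and m: "real n + 2 \<le> real m * \<eta>"
  shows "(2 * real N + 1) ^ n * ((real n * 3 ^ n) * (real N powr (- \<eta>) / 10 ^ n) ^ m)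
    < real n / real N ^ 2"
proof -
  have "m \<noteq> 0" using m by (intro notI) simp
  have "(real N powr (- \<eta>) / 10 ^ n) ^ m = real N powr (- (real m * \<eta>)) / (10 ^ n) ^ m"
    using N by (simp add: power_divide powr_power mult.commute)
  also have "\<dots> \<le> real N powr (- real (n + 2)) / (10 ^ n) ^ 1"
    using m N \<open>m \<noteq> 0\<close> by (intro frac_le powr_mono power_increasing) auto
  also have "real N powr (- real (n + 2)) = 1 / (real N ^ n * real N ^ 2)"
    using N by (simp only: powr_minus powr_realpow)
      (simp add: inverse_eq_divide powr_realpow power_add power2_eq_square)
  finally have "(real N powr (- \<eta>) / 10 ^ n) ^ m \<le> 1 / (real N ^ n * real N ^ 2) / 10 ^ n" by simp
  then have "(2 * real N + 1) ^ n * ((real n * 3 ^ n) * (real N powr (- \<eta>) / 10 ^ n) ^ m)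
      \<le> (3 * real N) ^ n * ((real n * 3 ^ n) * (1 / (real N ^ n * real N ^ 2) / 10 ^ n))"
    using N by (intro mult_mono power_mono) auto
  also have "\<dots> = (9 / 10) ^ n * (real n / real N ^ 2)"
  proof -
    have "(9::real) ^ n = 3 ^ n * 3 ^ n" by (simp flip: power_mult_distrib)
    then show ?thesis using N by (simp add: power_mult_distrib power_divide mult_ac)
  qed
  also have "\<dots> < 1 * (real n / real N ^ 2)"
    using n N by (intro mult_strict_right_mono) (auto simp: power_less_one_iff)
  finally show ?thesis by simp
qed

lemma diophantine_orbit_near_lattice:
  fixes \<omega> x :: "real^'n"
  assumes dio: "diophantine \<nu> \<eta> \<omega>" and N: "N \<ge> 2" and m: "real CARD('n) + 2 \<le> real m * \<eta>"
  defines "T \<equiv> 10 ^ CARD('n) * real CARD('n) powr \<eta> / (pi * \<nu>) * real N powr (2 * \<eta>)"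
  shows "\<exists>s\<in>{0..real m * T}. \<exists>z. int_vec z \<and> norm (x + s *\<^sub>R \<omega> - z) \<le> 2 * real CARD('n) / real N"
proof -
  define n where "n = CARD('n)"
  have n: "n \<ge> 1" by (simp add: n_def Suc_leI)
  have \<nu>: "0 < \<nu>" using dio by (simp add: diophantine_def)
  have T: "0 < T" using \<nu> n N by (simp add: T_def n_def[symmetric])
  obtain P A where P: "\<And>x :: real^'n. complex_of_real (P x) =
      (\<Sum>D\<in>freq_box N. A D * cis (2 * pi * (lattice_vec D \<bullet> x)))"
    and A: "\<And>D. \<bar>A D\<bar> \<le> real n * 3 ^ n" "real n / real N ^ 2 \<le> A (\<lambda>_. 0)"
    and near: "\<And>x. 0 < P x \<Longrightarrow> (\<Sum>i\<in>UNIV. 1 - cos (2 * pi * x $ i)) < 9 * real n / real N ^ 2"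
    by (rule localising_trig_poly[OF N, where 'n = 'n, folded n_def]) blast
  have "(real n * real N) powr \<eta> / (pi * \<nu> * T) = real N powr (- \<eta>) / 10 ^ n"
    using \<nu> n N
    by (simp add: T_def n_def[symmetric] powr_mult powr_minus field_simps flip: powr_add)
  then have "(2 * real N + 1) ^ n *
      ((real n * 3 ^ n) * ((real n * real N) powr \<eta> / (pi * \<nu> * T)) ^ m) < A (\<lambda>_. 0)"
    using damped_coefficient_sum_less[of N n m \<eta>] N n m A(2) by (simp add: n_def)
  then obtain s where s: "s \<in> {0..real m * T}" "0 < P (x + s *\<^sub>R \<omega>)"
    using trig_poly_positive_on_diophantine_orbit[OF dio T P A(1)] unfolding n_def by blast
  obtain z where z: "int_vec z"
    "8 * (norm (x + s *\<^sub>R \<omega> - z))\<^sup>2 \<le> (\<Sum>i\<in>UNIV. 1 - cos (2 * pi * (x + s *\<^sub>R \<omega>) $ i))"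
    by (rule lattice_distance_le_cos_sum)
  have "9 * real n / real N ^ 2 \<le> 8 * (2 * real n / real N)\<^sup>2"
    using n by (simp add: power_divide power_mult_distrib power2_eq_square divide_right_mono)
  then have "(norm (x + s *\<^sub>R \<omega> - z))\<^sup>2 \<le> (2 * real n / real N)\<^sup>2" using z(2) near[OF s(2)]
    by linarith
  then have "norm (x + s *\<^sub>R \<omega> - z) \<le> 2 * real n / real N" by (rule power2_le_imp_le) simp
  then show ?thesis using s(1) z(1) by (auto simp: n_def)
qed

lemma diophantine_orbit_dense:
  fixes \<omega> :: "real^'n"
  assumes dio: "diophantine \<nu> \<eta> \<omega>"
  obtains C where "C > 0"
    "\<And>\<delta> x. 0 < \<delta> \<Longrightarrow> \<delta> \<le> 1 \<Longrightarrow>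
      \<exists>s\<in>{0..C * \<delta> powr (- (2 * \<eta>))}. \<exists>z. int_vec z \<and> norm (x + s *\<^sub>R \<omega> - z) \<le> \<delta>"
proof -
  define n where "n = CARD('n)"
  have n: "n \<ge> 1" by (simp add: n_def Suc_leI)
  have \<eta>: "0 < \<eta>" using dio by (rule diophantine_exponent_pos)
  define m where "m = nat \<lceil>(real n + 2) / \<eta>\<rceil>"
  have "(real n + 2) / \<eta> \<le> real m" unfolding m_def by linarith
  then have m: "real n + 2 \<le> real m * \<eta>" using \<eta> by (simp add: field_simps)
  define B where "B = 10 ^ n * real n powr \<eta> / (pi * \<nu>)"
  have B: "0 < B" using dio n by (simp add: B_def diophantine_def)
  let ?C = "real m * B * (3 * real n) powr (2 * \<eta>)"
  show ?thesis
  proof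
    have "m \<noteq> 0" using m by (intro notI) simp
    then show "0 < ?C" using B n by simp
    fix \<delta> :: real and x :: "real^'n"
    assume \<delta>: "0 < \<delta>" "\<delta> \<le> 1"
    define N where "N = nat \<lceil>2 * real n / \<delta>\<rceil>"
    have ge: "2 * real n \<le> 2 * real n / \<delta>" "1 \<le> real n / \<delta>" using \<delta> n by (auto simp: field_simps)
    have N: "2 * real n / \<delta> \<le> real N" "real N \<le> 3 * real n / \<delta>"
      using ge n unfolding N_def by linarith+
    have "N \<ge> 2" using N(1) ge n by linarith
    from diophantine_orbit_near_lattice[OF dio this m[unfolded n_def], of x]
    obtain s z where s: "s \<in> {0..real m * (B * real N powr (2 * \<eta>))}" and z: "int_vec z"
      and near: "norm (x + s *\<^sub>R \<omega> - z) \<le> 2 * real n / real N"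
      unfolding n_def B_def by blast
    have "real N powr (2 * \<eta>) \<le> (3 * real n / \<delta>) powr (2 * \<eta>)"
      using N(2) \<eta> by (intro powr_mono2) auto
    also have "\<dots> = (3 * real n) powr (2 * \<eta>) * \<delta> powr (- (2 * \<eta>))"
      using \<delta> by (simp add: powr_divide powr_minus field_simps)
    finally have "real m * (B * real N powr (2 * \<eta>)) \<le> ?C * \<delta> powr (- (2 * \<eta>))"
      using B by (simp add: mult.assoc mult_left_mono)
    moreover have "2 * real n / real N \<le> \<delta>" using N(1) \<open>N \<ge> 2\<close> \<delta> by (simp add: field_simps)
    ultimately show "\<exists>s\<in>{0..?C * \<delta> powr (- (2 * \<eta>))}. \<exists>z. int_vec z \<and> norm (x + s *\<^sub>R \<omega> - z) \<le> \<delta>"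
      using s z near by (intro bexI[of _ s] exI[of _ z]) auto
  qed
qed

section \<open>Superdifferentials and sup-convolutions\<close>

definition superdiff :: "(real^'n \<Rightarrow> real) \<Rightarrow> real^'n \<Rightarrow> (real^'n) set" where
  "superdiff u x = {p. \<exists>\<phi> D\<phi>. C1_test \<phi> D\<phi> \<and> (\<forall>y. u y - \<phi> y \<le> u x - \<phi> x) \<and> D\<phi> x = p}"

definition subdiff :: "(real^'n \<Rightarrow> real) \<Rightarrow> real^'n \<Rightarrow> (real^'n) set" where
  "subdiff u x = {p. \<exists>\<phi> D\<phi>. C1_test \<phi> D\<phi> \<and> (\<forall>y. u y - \<phi> y \<ge> u x - \<phi> x) \<and> D\<phi> x = p}"

lemma superdiffI: "C1_test \<phi> D\<phi> \<Longrightarrow> (\<And>y. u y - \<phi> y \<le> u x - \<phi> x) \<Longrightarrow> D\<phi> x \<in> superdiff u x"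
  unfolding superdiff_def by blast

lemma subdiffI: "C1_test \<phi> D\<phi> \<Longrightarrow> (\<And>y. u y - \<phi> y \<ge> u x - \<phi> x) \<Longrightarrow> D\<phi> x \<in> subdiff u x"
  unfolding subdiff_def by blast

definition hj_subsolution :: "(real^'n \<Rightarrow> real^'n \<Rightarrow> real) \<Rightarrow> real \<Rightarrow> (real^'n \<Rightarrow> real) \<Rightarrow> bool" where
  "hj_subsolution H k u \<longleftrightarrow> (\<forall>x. \<forall>p\<in>superdiff u x. H x p \<le> k)"

lemma viscosity_solution_continuous: "viscosity_solution F u \<Longrightarrow> continuous_on UNIV u"
  and viscosity_solution_periodic: "viscosity_solution F u \<Longrightarrow> periodic_fun u"
  by (simp_all add: viscosity_solution_def)

lemma viscosity_solution_superdiff: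
  assumes "viscosity_solution F u" "p \<in> superdiff u x"
  shows "F x (u x) p \<le> 0"
proof -
  obtain \<phi> D\<phi> where \<phi>: "C1_test \<phi> D\<phi>" "\<forall>y. u y - \<phi> y \<le> u x - \<phi> x" "D\<phi> x = p"
    using assms(2) unfolding superdiff_def by blast
  then have "\<exists>r>0. \<forall>y\<in>ball x r. u y - \<phi> y \<le> u x - \<phi> x" by (intro exI[of _ 1]) auto
  then show ?thesis using assms(1) \<phi> unfolding viscosity_solution_def by blast
qed

lemma viscosity_solution_subdiff:
  assumes "viscosity_solution F u" "p \<in> subdiff u x"
  shows "F x (u x) p \<ge> 0"
proof -
  obtain \<phi> D\<phi> where \<phi>: "C1_test \<phi> D\<phi>" "\<forall>y. u y - \<phi> y \<ge> u x - \<phi> x" "D\<phi> x = p"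
    using assms(2) unfolding subdiff_def by blast
  then have "\<exists>r>0. \<forall>y\<in>ball x r. u y - \<phi> y \<ge> u x - \<phi> x" by (intro exI[of _ 1]) auto
  then show ?thesis using assms(1) \<phi> unfolding viscosity_solution_def by blast
qed

lemma viscosity_solution_classical:
  assumes "viscosity_solution F v" "C1_test v g"
  shows "F x (v x) (g x) = 0"
proof (rule order_antisym)
  show "F x (v x) (g x) \<le> 0"
    by (rule viscosity_solution_superdiff[OF assms(1) superdiffI[OF assms(2)]]) simp
  show "F x (v x) (g x) \<ge> 0"
    by (rule viscosity_solution_subdiff[OF assms(1) subdiffI[OF assms(2)]]) simp
qed

lemma continuous_on_C1_test: "C1_test \<phi> D\<phi> \<Longrightarrow> continuous_on S \<phi>"
  unfolding C1_test_def by (meson has_derivative_continuous_on has_derivative_at_withinI)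

lemma has_derivative_norm_square:
  fixes x :: "'a::real_inner"
  shows "((\<lambda>y. (norm (y - x))\<^sup>2) has_derivative (\<lambda>k. (2 *\<^sub>R (y - x)) \<bullet> k)) (at y)"
proof -
  have shift: "((\<lambda>y. y - x) has_derivative (\<lambda>k. k)) (at y)" by (auto intro!: derivative_eq_intros)
  show ?thesis unfolding power2_norm_eq_inner
    by (rule has_derivative_eq_rhs[OF has_derivative_inner[OF shift shift]])
       (simp add: fun_eq_iff inner_commute)
qed

lemma C1_test_quadratic: "C1_test (\<lambda>y. A * (norm (y - x))\<^sup>2) (\<lambda>y. (2 * A) *\<^sub>R (y - x))"
  unfolding C1_test_def
  by (auto intro!: continuous_intros simp: fun_eq_iff
      intro!: has_derivative_eq_rhs[OF has_derivative_mult_right[OF has_derivative_norm_square]])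

lemma attains_max_if_le_outside_cball:
  fixes f :: "'a::heine_borel \<Rightarrow> real"
  assumes cont: "continuous_on UNIV f" and r: "0 \<le> r" and outside: "\<And>y. r < dist x y \<Longrightarrow> f y \<le> f x"
  obtains y where "\<And>y'. f y' \<le> f y"
proof -
  have "compact (cball x r)" "x \<in> cball x r" "continuous_on (cball x r) f"
    using r cont by (auto intro: continuous_on_subset)
  then obtain y where y: "\<And>y'. y' \<in> cball x r \<Longrightarrow> f y' \<le> f y"
    using continuous_attains_sup[of "cball x r" f] by blast
  have "f y' \<le> f y" for y'
    using y[of y'] y[OF \<open>x \<in> cball x r\<close>] outside[of y'] by (cases "y' \<in> cball x r") auto
  then show ?thesis by (rule that)
qed

text \<open>Let \<open>K > R\<close> and suppose that all supergradients of \<open>u\<close> are bounded by \<open>R\<close>. The slope of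
  \<open>K smoothed_dist \<delta> b\<close> exceeds \<open>R\<close> away from \<open>b\<close>, so \<open>u - K smoothed_dist \<delta> b\<close> attains its
  maximum near \<open>b\<close>; letting \<open>\<delta> \<rightarrow> 0\<close> and \<open>K \<rightarrow> R\<close> gives the Lipschitz bound.\<close>

definition smoothed_dist :: "real \<Rightarrow> 'a::real_normed_vector \<Rightarrow> 'a \<Rightarrow> real" where
  "smoothed_dist \<delta> b y = sqrt (\<delta>\<^sup>2 + (norm (y - b))\<^sup>2)"

lemma smoothed_dist_bounds:
  assumes "0 < \<delta>"
  shows "\<delta> \<le> smoothed_dist \<delta> b y" "norm (y - b) \<le> smoothed_dist \<delta> b y"
    "smoothed_dist \<delta> b y \<le> \<delta> + norm (y - b)" "smoothed_dist \<delta> b b = \<delta>"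
  using assms sqrt_sum_squares_le_sum[of \<delta> "norm (y - b)"]
  by (auto simp: smoothed_dist_def real_le_rsqrt)

lemma C1_test_smoothed_dist:
  assumes "0 < \<delta>"
  shows "C1_test (\<lambda>y. K * smoothed_dist \<delta> b y) (\<lambda>y. (K / smoothed_dist \<delta> b y) *\<^sub>R (y - b))"
proof -
  have pos: "0 < \<delta>\<^sup>2 + (norm (y - b))\<^sup>2" for y using assms by (simp add: add_pos_nonneg)
  have "continuous_on UNIV (\<lambda>y. (K / smoothed_dist \<delta> b y) *\<^sub>R (y - b))"
    unfolding smoothed_dist_def using pos by (intro continuous_intros) (auto simp: less_le)
  moreover have "((\<lambda>y. K * smoothed_dist \<delta> b y) has_derivative
      (\<lambda>k. ((K / smoothed_dist \<delta> b y) *\<^sub>R (y - b)) \<bullet> k)) (at y)" for y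
  proof -
    have "((\<lambda>y. \<delta>\<^sup>2 + (norm (y - b))\<^sup>2) has_derivative (\<lambda>k. 0 + (2 *\<^sub>R (y - b)) \<bullet> k)) (at y)"
      by (intro has_derivative_add has_derivative_const has_derivative_norm_square)
    from has_derivative_mult_right[OF has_derivative_real_sqrt[OF pos this], of K]
    show ?thesis
      unfolding smoothed_dist_def
      by (rule has_derivative_eq_rhs) (simp add: fun_eq_iff inverse_eq_divide)
  qed
  ultimately show ?thesis by (simp add: C1_test_def)
qed

lemma smoothed_dist_slope_small:
  assumes "0 \<le> R" "R < K" "0 < d"
    and slope: "K * norm (y - b) \<le> R * smoothed_dist (d * sqrt (K\<^sup>2 - R\<^sup>2) / K) b y"
  shows "norm (y - b) < d"
proof (rule ccontr)
  define t where "t = norm (y - b)"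
  assume "\<not> norm (y - b) < d"
  then have t: "d\<^sup>2 \<le> t\<^sup>2" using assms(3) unfolding t_def by (intro power_mono) auto
  have gap: "0 < K\<^sup>2 - R\<^sup>2" using assms(1,2) by (simp add: power_strict_mono)
  have "(K * t)\<^sup>2 \<le> (R * smoothed_dist (d * sqrt (K\<^sup>2 - R\<^sup>2) / K) b y)\<^sup>2"
    using slope assms(1,2) unfolding t_def by (intro power_mono) auto
  also have "\<dots> = R\<^sup>2 * (d\<^sup>2 * (K\<^sup>2 - R\<^sup>2) / K\<^sup>2 + t\<^sup>2)"
    using gap by (simp add: power_mult_distrib smoothed_dist_def power_divide t_def)
  finally have "K\<^sup>2 * ((K\<^sup>2 - R\<^sup>2) * t\<^sup>2) \<le> R\<^sup>2 * ((K\<^sup>2 - R\<^sup>2) * d\<^sup>2)"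
    using assms(1,2) by (simp add: power_mult_distrib field_simps)
  also have "\<dots> \<le> R\<^sup>2 * ((K\<^sup>2 - R\<^sup>2) * t\<^sup>2)" using t gap by (intro mult_left_mono) auto
  finally have "(K\<^sup>2 - R\<^sup>2) * ((K\<^sup>2 - R\<^sup>2) * t\<^sup>2) \<le> 0" by (simp add: algebra_simps)
  then have "t\<^sup>2 \<le> 0" using gap by (simp add: mult_le_0_iff)
  then show False using t assms(3) by simp
qed

lemma superdiff_bound_imp_increment_le:
  fixes u :: "real^'n \<Rightarrow> real"
  assumes cont: "continuous_on UNIV u" and bounded: "\<And>y. \<bar>u y\<bar> \<le> B"
    and grad: "\<And>x p. p \<in> superdiff u x \<Longrightarrow> norm p \<le> R" and R: "0 \<le> R" "R < K"
  shows "u a - u b \<le> K * norm (a - b)"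
proof (rule field_le_epsilon)
  fix e :: real assume "0 < e"
  then obtain d where d: "0 < d" "\<And>y. dist y b < d \<Longrightarrow> dist (u y) (u b) < e"
    using cont unfolding continuous_on_iff by (metis UNIV_I)
  have K: "0 < K" "R\<^sup>2 < K\<^sup>2" using R by (auto simp: power_strict_mono)
  define \<delta> where "\<delta> = d * sqrt (K\<^sup>2 - R\<^sup>2) / K"
  have \<delta>: "0 < \<delta>" using d(1) K by (simp add: \<delta>_def)
  note s = smoothed_dist_bounds[OF \<delta>, where b = b]
  have B: "0 \<le> B" using bounded[of b] by simp
  obtain y where y: "\<And>y'. u y' - K * smoothed_dist \<delta> b y' \<le> u y - K * smoothed_dist \<delta> b y"
  proof (rule attains_max_if_le_outside_cball)
    show "continuous_on UNIV (\<lambda>y. u y - K * smoothed_dist \<delta> b y)"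
      by (intro continuous_on_diff cont continuous_on_C1_test[OF C1_test_smoothed_dist[OF \<delta>]])
    show "0 \<le> 2 * B / K + \<delta>" using B K \<delta> by simp
    fix y' assume "2 * B / K + \<delta> < dist b y'"
    then have "2 * B / K + \<delta> \<le> smoothed_dist \<delta> b y'"
      using s(2)[of y'] by (simp add: dist_norm norm_minus_commute)
    then have "2 * B + K * \<delta> \<le> K * smoothed_dist \<delta> b y'"
      using mult_left_mono[of "2 * B / K + \<delta>" _ K] K by (simp add: distrib_left)
    then show "u y' - K * smoothed_dist \<delta> b y' \<le> u b - K * smoothed_dist \<delta> b b"
      using bounded[of y'] bounded[of b] s(4) by (simp add: abs_le_iff)
  qed blast
  have "norm ((K / smoothed_dist \<delta> b y) *\<^sub>R (y - b)) \<le> R"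
    by (rule grad[OF superdiffI[OF C1_test_smoothed_dist[OF \<delta>] y]])
  then have "K * norm (y - b) \<le> R * smoothed_dist \<delta> b y"
    using K(1) s(1)[of y] \<delta> unfolding norm_scaleR by (simp add: field_simps)
  then have "norm (y - b) < d" using smoothed_dist_slope_small[OF R d(1)] by (simp add: \<delta>_def)
  then have "u y \<le> u b + e" using d(2)[of y] by (simp add: dist_norm)
  moreover have "K * smoothed_dist \<delta> b a \<le> K * smoothed_dist \<delta> b y + K * norm (a - b)"
    using s(1)[of y] s(3)[of a] K by (simp flip: distrib_left)
  ultimately show "u a - u b \<le> K * norm (a - b) + e" using y[of a] by linarith
qed

lemma superdiff_bound_imp_lipschitz:
  fixes u :: "real^'n \<Rightarrow> real"
  assumes cont: "continuous_on UNIV u" and bounded: "\<And>y. \<bar>u y\<bar> \<le> B"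
    and grad: "\<And>x p. p \<in> superdiff u x \<Longrightarrow> norm p \<le> R" and R: "0 \<le> R"
  shows "R-lipschitz_on UNIV u"
proof (rule lipschitz_onI)
  have increment: "u a - u b \<le> R * norm (a - b)" for a b
  proof (cases "a = b")
    case False
    have "(u a - u b) / norm (a - b) \<le> R"
    proof (rule dense_ge)
      fix K assume "R < K"
      then show "(u a - u b) / norm (a - b) \<le> K"
        using superdiff_bound_imp_increment_le[OF cont bounded _ R, where a = a and b = b and K = K]
          grad False
        by (simp add: field_simps)
    qed
    then show ?thesis using False by (simp add: field_simps)
  qed simp
  show "dist (u x) (u y) \<le> R * dist x y" for x y
    using increment[of x y] increment[of y x] by (simp add: dist_norm abs_le_iff norm_minus_commute)
qed (rule R)

definition sup_conv :: "real \<Rightarrow> ('a::real_normed_vector \<Rightarrow> real) \<Rightarrow> 'a \<Rightarrow> real" where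
  "sup_conv A u x = (SUP y. u y - A * (norm (y - x))\<^sup>2)"

context
  fixes u :: "'a::euclidean_space \<Rightarrow> real" and R A B :: real
  assumes lipschitz: "R-lipschitz_on UNIV u" and bounded: "\<And>y. \<bar>u y\<bar> \<le> B" and A: "0 < A"
begin

lemma sup_conv_attained:
  obtains y where "sup_conv A u x = u y - A * (norm (y - x))\<^sup>2"
    "\<And>y'. u y' - A * (norm (y' - x))\<^sup>2 \<le> u y - A * (norm (y - x))\<^sup>2"
proof -
  obtain y where y: "\<And>y'. u y' - A * (norm (y' - x))\<^sup>2 \<le> u y - A * (norm (y - x))\<^sup>2"
  proof (rule attains_max_if_le_outside_cball)
    show "continuous_on UNIV (\<lambda>y. u y - A * (norm (y - x))\<^sup>2)"
      by (intro continuous_intros lipschitz_on_continuous_on[OF lipschitz])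
    have B: "0 \<le> B" using bounded[of x] by simp
    then show "0 \<le> sqrt (2 * B / A)" using A by simp
    fix y' assume "sqrt (2 * B / A) < dist x y'"
    then have "2 * B / A \<le> (norm (y' - x))\<^sup>2"
      by (metis dist_norm less_imp_le norm_minus_commute norm_ge_zero real_le_lsqrt not_le sqrt_le_D)
    then have "2 * B \<le> A * (norm (y' - x))\<^sup>2" using A by (simp add: field_simps)
    then show "u y' - A * (norm (y' - x))\<^sup>2 \<le> u x - A * (norm (x - x))\<^sup>2"
      using bounded[of x] bounded[of y'] by (simp add: abs_le_iff)
  qed blast
  moreover have "sup_conv A u x = u y - A * (norm (y - x))\<^sup>2"
    unfolding sup_conv_def by (rule cSup_eq_maximum) (use y in auto)
  ultimately show ?thesis using that by blast
qed

lemma sup_conv_ge: "u y - A * (norm (y - x))\<^sup>2 \<le> sup_conv A u x"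
proof -
  obtain z where "sup_conv A u x = u z - A * (norm (z - x))\<^sup>2"
    "\<And>y'. u y' - A * (norm (y' - x))\<^sup>2 \<le> u z - A * (norm (z - x))\<^sup>2"
    by (rule sup_conv_attained[of x]) blast
  then show ?thesis by simp
qed

lemma sup_conv_maximiser_near:
  assumes "sup_conv A u x = u y - A * (norm (y - x))\<^sup>2"
  shows "norm (y - x) \<le> R / A"
proof -
  have "A * (norm (y - x))\<^sup>2 \<le> R * norm (y - x)"
    using sup_conv_ge[of x x] assms lipschitz_on_normD[OF lipschitz, of y x] by simp
  then have "(A * norm (y - x)) * norm (y - x) \<le> R * norm (y - x)"
    by (simp add: power2_eq_square)
  then have "A * norm (y - x) \<le> R"
    using lipschitz_on_nonneg[OF lipschitz]
    by (cases "norm (y - x) = 0") (auto simp: mult_le_cancel_right)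
  then show ?thesis using A by (simp add: field_simps)
qed

lemma sup_conv_le: "sup_conv A u x \<le> u x + R\<^sup>2 / A"
proof -
  obtain y where y: "sup_conv A u x = u y - A * (norm (y - x))\<^sup>2" by (rule sup_conv_attained)
  have "u y - u x \<le> R * norm (y - x)" using lipschitz_on_normD[OF lipschitz, of y x] by simp
  also have "\<dots> \<le> R * (R / A)"
    using sup_conv_maximiser_near[OF y] lipschitz_on_nonneg[OF lipschitz] by (rule mult_left_mono)
  finally have "u y - u x \<le> R\<^sup>2 / A" by (simp add: power2_eq_square)
  moreover have "0 \<le> A * (norm (y - x))\<^sup>2" using A by simp
  ultimately show ?thesis using y by linarith
qed

lemma lipschitz_on_sup_conv: "R-lipschitz_on UNIV (sup_conv A u)"
proof (rule lipschitz_onI)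
  have increment: "sup_conv A u x - sup_conv A u x' \<le> R * norm (x - x')" for x x'
  proof -
    obtain y where "sup_conv A u x = u y - A * (norm (y - x))\<^sup>2" by (rule sup_conv_attained)
    moreover have "u (y + (x' - x)) - A * (norm (y - x))\<^sup>2 \<le> sup_conv A u x'"
      using sup_conv_ge[of "y + (x' - x)" x'] by simp
    moreover have "u y - u (y + (x' - x)) \<le> R * norm (x - x')"
      using lipschitz_on_normD[OF lipschitz, of y "y + (x' - x)"] by (simp add: norm_minus_commute)
    ultimately show ?thesis by linarith
  qed
  show "dist (sup_conv A u x) (sup_conv A u x') \<le> R * dist x x'" for x x'
    using increment[of x x'] increment[of x' x]
    by (simp add: dist_norm abs_le_iff norm_minus_commute)
qed (rule lipschitz_on_nonneg[OF lipschitz])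

end

lemma uniformly_close_on_bounded:
  fixes F :: "('a::euclidean_space) \<times> ('b::euclidean_space) \<Rightarrow> real"
  assumes "continuous_on UNIV F" "bounded S" "0 < e"
  obtains d where "0 < d"
    "\<And>x y p. x \<in> S \<Longrightarrow> norm (y - x) < d \<Longrightarrow> norm p \<le> r \<Longrightarrow> \<bar>F (x, p) - F (y, p)\<bar> < e"
proof -
  obtain \<rho> where \<rho>: "\<And>x. x \<in> S \<Longrightarrow> norm x \<le> \<rho>" using assms(2) unfolding bounded_iff by blast
  define Z where "Z = cball (0::'a) (\<rho> + 1) \<times> cball (0::'b) r"
  have "uniformly_continuous_on Z F"
    unfolding Z_def
    by (intro compact_uniformly_continuous continuous_on_subset[OF assms(1)] compact_Times) auto
  then obtain d where d: "0 < d" "\<And>z z'. z \<in> Z \<Longrightarrow> z' \<in> Z \<Longrightarrow> dist z' z < d \<Longrightarrow> dist (F z') (F z) < e"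
    using assms(3) by (rule uniformly_continuous_onE) blast
  show ?thesis
  proof
    show "0 < min d 1" using d(1) by simp
    fix x y :: 'a and p :: 'b
    assume x: "x \<in> S" and y: "norm (y - x) < min d 1" and p: "norm p \<le> r"
    have "(x, p) \<in> Z" "(y, p) \<in> Z"
      using \<rho>[OF x] y p norm_triangle_sub[of y x] by (auto simp: Z_def)
    moreover have "dist (x, p) (y, p) < d" using y
      by (simp add: dist_Pair_Pair dist_norm norm_minus_commute)
    ultimately show "\<bar>F (x, p) - F (y, p)\<bar> < e" using d(2) by (simp add: dist_norm)
  qed
qed

section \<open>Subsolutions along characteristics\<close>

lemma increment_le_if_supported_below:
  fixes f :: "real \<Rightarrow> real"
  assumes ab: "a \<le> b" and cont: "continuous_on {a..b} f"
    and support: "\<And>s. a < s \<Longrightarrow> s \<le> b \<Longrightarrow>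
      \<exists>\<zeta> D. (\<zeta> has_real_derivative D) (at s) \<and> D \<le> K \<and> (\<forall>t. \<zeta> t - \<zeta> s \<le> f t - f s)"
  shows "f b - f a \<le> K * (b - a)"
proof -
  have strict: "f b - f a \<le> K' * (b - a)" if "K < K'" for K'
  proof -
    have "continuous_on {a..b} (\<lambda>s. f s - K' * s)" by (intro continuous_intros cont)
    then obtain s where s: "s \<in> {a..b}" "\<And>t. t \<in> {a..b} \<Longrightarrow> f t - K' * t \<le> f s - K' * s"
      using continuous_attains_sup[of "{a..b}" "\<lambda>s. f s - K' * s"] ab by auto
    have "s = a"
    proof (rule ccontr)
      assume "s \<noteq> a"
      with s(1) have "a < s" "s \<le> b" by auto
      then obtain \<zeta> D where \<zeta>: "(\<zeta> has_real_derivative D) (at s)" "D \<le> K"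
        "\<And>t. \<zeta> t - \<zeta> s \<le> f t - f s"
        using support by blast
      have "((\<lambda>t. \<zeta> t - K' * t) has_real_derivative D - K') (at s)"
        by (auto intro!: derivative_eq_intros \<zeta>)
      moreover have "D - K' < 0" using \<zeta>(2) \<open>K < K'\<close> by simp
      ultimately obtain d where d: "0 < d"
        "\<And>h. 0 < h \<Longrightarrow> h < d \<Longrightarrow> \<zeta> s - K' * s < \<zeta> (s - h) - K' * (s - h)"
        using DERIV_neg_dec_left by blast
      define h where "h = min (d / 2) (s - a)"
      have h: "0 < h" "h < d" "s - h \<in> {a..b}" using d(1) \<open>a < s\<close> \<open>s \<le> b\<close> by (auto simp: h_def)
      show False using d(2)[OF h(1,2)] s(2)[OF h(3)] \<zeta>(3)[of "s - h"] by linarith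
    qed
    then show ?thesis using s(2)[of b] ab by (simp add: algebra_simps)
  qed
  show ?thesis
  proof (cases "a = b")
    case False
    have "(f b - f a) / (b - a) \<le> K"
      by (rule dense_ge) (use strict ab False in \<open>simp add: field_simps\<close>)
    then show ?thesis using ab False by (simp add: field_simps)
  qed simp
qed

lemma sup_conv_approximate_subsolution:
  fixes u :: "real^'n \<Rightarrow> real" and H :: "real^'n \<Rightarrow> real^'n \<Rightarrow> real"
  assumes contH: "continuous_on UNIV (\<lambda>z. H (fst z) (snd z))"
    and lipschitz: "R-lipschitz_on UNIV u" and bounded: "\<And>y. \<bar>u y\<bar> \<le> B"
    and subsolution: "hj_subsolution H k u"
    and S: "bounded S" and e: "0 < e"
  obtains A where "0 < A" "\<And>x. sup_conv A u x \<le> u x + e"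
    "\<And>x y. x \<in> S \<Longrightarrow> sup_conv A u x = u y - A * (norm (y - x))\<^sup>2 \<Longrightarrow> H x ((2 * A) *\<^sub>R (y - x)) \<le> k + e"
proof -
  have R: "0 \<le> R" using lipschitz by (rule lipschitz_on_nonneg)
  obtain d where d: "0 < d"
    "\<And>x y p. x \<in> S \<Longrightarrow> norm (y - x) < d \<Longrightarrow> norm p \<le> 2 * R \<Longrightarrow> \<bar>H x p - H y p\<bar> < e"
    using uniformly_close_on_bounded[OF contH S e, of "2 * R"] by auto
  define A where "A = (R + 1) / d + R\<^sup>2 / e"
  have A: "0 < A" using R d(1) e by (simp add: A_def add_pos_nonneg)
  have "R < (R + 1) / d * d" using d(1) by simp
  also have "\<dots> \<le> A * d" using d(1) e by (intro mult_right_mono) (auto simp: A_def)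
  finally have RA: "R / A < d" using A by (simp add: field_simps)
  have "R\<^sup>2 / e * e \<le> A * e" using R d(1) e by (intro mult_right_mono) (auto simp: A_def)
  then have R2A: "R\<^sup>2 / A \<le> e" using A e by (simp add: field_simps)
  show ?thesis
  proof
    show "sup_conv A u x \<le> u x + e" for x using sup_conv_le[OF lipschitz bounded A, of x] R2A
      by simp
    fix x y assume x: "x \<in> S" and y: "sup_conv A u x = u y - A * (norm (y - x))\<^sup>2"
    let ?p = "(2 * A) *\<^sub>R (y - x)"
    have near: "norm (y - x) \<le> R / A" by (rule sup_conv_maximiser_near[OF lipschitz bounded A y])
    then have "A * norm (y - x) \<le> R" using A by (simp add: field_simps)
    then have "norm ?p \<le> 2 * R" using A unfolding norm_scaleR by simp
    then have "\<bar>H x ?p - H y ?p\<bar> < e" using near RA by (intro d(2) x) auto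
    moreover have "?p \<in> superdiff u y"
      using sup_conv_ge[OF lipschitz bounded A, of _ x] y
      by (intro superdiffI[OF C1_test_quadratic]) simp
    ultimately show "H x ?p \<le> k + e" using subsolution unfolding hj_subsolution_def by fastforce
  qed (rule A)
qed

text \<open>If \<open>y\<close> attains the sup-convolution at \<open>X s\<close>, then keeping \<open>y\<close> fixed while \<open>X\<close> moves
  supports it from below, with slope bounded by convexity of \<open>H\<close>.\<close>

lemma sup_conv_along_characteristic:
  fixes u v :: "real^'n \<Rightarrow> real" and X :: "real \<Rightarrow> real^'n" and H :: "real^'n \<Rightarrow> real^'n \<Rightarrow> real"
  assumes convex: "\<And>x p q. H x p + b x p \<bullet> (q - p) \<le> H x q"
    and lipschitz: "R-lipschitz_on UNIV u" and bounded: "\<And>y. \<bar>u y\<bar> \<le> B" and A: "0 < A"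
    and subsolution: "\<And>s y. s \<in> {0..T} \<Longrightarrow> sup_conv A u (X s) = u y - A * (norm (y - X s))\<^sup>2
      \<Longrightarrow> H (X s) ((2 * A) *\<^sub>R (y - X s)) \<le> k"
    and v: "\<And>x. (v has_derivative (\<lambda>h. g x \<bullet> h)) (at x)" "\<And>x. H x (g x) = h"
    and X: "\<And>s. (X has_vector_derivative b (X s) (g (X s))) (at s)" and T: "0 \<le> T"
  shows "(sup_conv A u (X T) - v (X T)) - (sup_conv A u (X 0) - v (X 0)) \<le> (k - h) * (T - 0)"
proof (rule increment_le_if_supported_below[OF T])
  have contX: "continuous_on {0..T} X"
    using X by (intro continuous_at_imp_continuous_on)
      (auto intro: has_vector_derivative_continuous)
  have "continuous_on UNIV v" using v(1)
    by (meson has_derivative_continuous_on has_derivative_at_withinI)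
  moreover have "continuous_on UNIV (sup_conv A u)"
    by (rule lipschitz_on_continuous_on[OF lipschitz_on_sup_conv[OF lipschitz bounded A]])
  ultimately have "continuous_on UNIV (\<lambda>x. sup_conv A u x - v x)" by (intro continuous_on_diff)
  then show "continuous_on {0..T} (\<lambda>s. sup_conv A u (X s) - v (X s))"
    by (rule continuous_on_compose2[OF _ contX]) simp
  fix s assume s: "0 < s" "s \<le> T"
  obtain y where y: "sup_conv A u (X s) = u y - A * (norm (y - X s))\<^sup>2"
    by (rule sup_conv_attained[OF lipschitz bounded A])
  define p where "p = (2 * A) *\<^sub>R (y - X s)"
  define X' where "X' = b (X s) (g (X s))"
  define \<zeta> where "\<zeta> t = - A * (norm (X t - y))\<^sup>2 - v (X t)" for t
  have X_deriv: "(X has_derivative (\<lambda>h. h *\<^sub>R X')) (at s)"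
    using X[of s] by (simp add: has_vector_derivative_def X'_def)
  have "(\<zeta> has_derivative (\<lambda>h. h * ((p - g (X s)) \<bullet> X'))) (at s)"
    unfolding \<zeta>_def[abs_def] p_def
    by (rule has_derivative_eq_rhs[OF has_derivative_diff[OF
          has_derivative_mult_right[OF has_derivative_compose[OF X_deriv has_derivative_norm_square]]
          has_derivative_compose[OF X_deriv v(1)]]])
       (simp add: fun_eq_iff inner_diff_left algebra_simps)
  then have "(\<zeta> has_real_derivative (p - g (X s)) \<bullet> X') (at s)"
    by (simp add: has_field_derivative_def mult_commute_abs)
  moreover have "(p - g (X s)) \<bullet> X' \<le> k - h"
    using convex[of "X s" "g (X s)" p] subsolution[OF _ y] s
    by (simp add: v(2) X'_def p_def inner_commute)
  moreover have "\<zeta> t - \<zeta> s \<le> (sup_conv A u (X t) - v (X t)) - (sup_conv A u (X s) - v (X s))" for t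
    using sup_conv_ge[OF lipschitz bounded A, of y "X t"] y by (simp add: \<zeta>_def norm_minus_commute)
  ultimately show "\<exists>\<zeta> D. (\<zeta> has_real_derivative D) (at s) \<and> D \<le> k - h \<and>
      (\<forall>t. \<zeta> t - \<zeta> s \<le> sup_conv A u (X t) - v (X t) - (sup_conv A u (X s) - v (X s)))" by blast
qed

lemma subsolution_along_characteristic:
  fixes u v :: "real^'n \<Rightarrow> real" and X :: "real \<Rightarrow> real^'n" and H :: "real^'n \<Rightarrow> real^'n \<Rightarrow> real"
  assumes contH: "continuous_on UNIV (\<lambda>z. H (fst z) (snd z))"
    and convex: "\<And>x p q. H x p + b x p \<bullet> (q - p) \<le> H x q"
    and lipschitz: "R-lipschitz_on UNIV u" and bounded: "\<And>y. \<bar>u y\<bar> \<le> B"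
    and subsolution: "hj_subsolution H k u"
    and v: "\<And>x. (v has_derivative (\<lambda>h. g x \<bullet> h)) (at x)" "\<And>x. H x (g x) = h"
    and X: "\<And>s. (X has_vector_derivative b (X s) (g (X s))) (at s)" and T: "0 \<le> T"
  shows "u (X T) - v (X T) \<le> u (X 0) - v (X 0) + (k - h) * T"
proof (rule field_le_epsilon)
  fix e0 :: real assume "0 < e0"
  define e where "e = e0 / (1 + T)"
  have e: "0 < e" "e * (1 + T) = e0" using \<open>0 < e0\<close> T by (auto simp: e_def)
  have "continuous_on {0..T} X"
    using X by (intro continuous_at_imp_continuous_on)
      (auto intro: has_vector_derivative_continuous)
  then have "bounded (X ` {0..T})" by (intro compact_imp_bounded compact_continuous_image) auto
  then obtain A where A: "0 < A" and upper: "\<And>x. sup_conv A u x \<le> u x + e"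
    and approx: "\<And>x y. x \<in> X ` {0..T} \<Longrightarrow> sup_conv A u x = u y - A * (norm (y - x))\<^sup>2 \<Longrightarrow>
      H x ((2 * A) *\<^sub>R (y - x)) \<le> k + e"
    using sup_conv_approximate_subsolution[OF contH lipschitz bounded subsolution _ e(1)] by blast
  have "(sup_conv A u (X T) - v (X T)) - (sup_conv A u (X 0) - v (X 0)) \<le> (k + e - h) * (T - 0)"
    using approx
    by (intro sup_conv_along_characteristic[OF convex lipschitz bounded A _ v X T]) auto
  moreover have "u (X T) \<le> sup_conv A u (X T)"
    using sup_conv_ge[OF lipschitz bounded A, of "X T" "X T"] by simp
  moreover have "(k + e - h) * (T - 0) + e = (k - h) * T + e0" using e(2)
    by (simp add: algebra_simps)
  ultimately show "u (X T) - v (X T) \<le> u (X 0) - v (X 0) + (k - h) * T + e0"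
    using upper[of "X 0"] by linarith
qed

section \<open>Periodic functions\<close>

lemma int_vec_add: "int_vec x \<Longrightarrow> int_vec y \<Longrightarrow> int_vec (x + y)"
  by (simp add: int_vec_def)

lemma int_vec_minus: "int_vec x \<Longrightarrow> int_vec (- x)"
  by (simp add: int_vec_def)

lemma tor_eq_refl: "tor_eq x x"
  by (simp add: tor_eq_def int_vec_def)

lemma tor_eq_sym: "tor_eq x y \<Longrightarrow> tor_eq y x"
  using int_vec_minus[of "x - y"] by (simp add: tor_eq_def)

lemma tor_eq_trans: "tor_eq x y \<Longrightarrow> tor_eq y z \<Longrightarrow> tor_eq x z"
  using int_vec_add[of "x - y" "y - z"] by (simp add: tor_eq_def)

lemma tor_eq_displace:
  assumes "tor_eq x a" "tor_eq y b"
  obtains y' where "tor_eq y' y" "y' - x = b - a"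
proof
  have "tor_eq (b + (x - a)) b" using assms(1) by (simp add: tor_eq_def)
  then show "tor_eq (b + (x - a)) y" using tor_eq_trans tor_eq_sym[OF assms(2)] by blast
qed simp

lemma periodic_fun_tor_eq:
  assumes "periodic_fun f" "tor_eq x y"
  shows "f x = f y"
proof -
  have "f (y + (x - y)) = f y" using assms unfolding periodic_fun_def tor_eq_def by blast
  then show ?thesis by simp
qed

lemma tor_eq_unit_cube:
  fixes x :: "real^'n"
  obtains y where "y \<in> cbox 0 1" "tor_eq x y"
proof
  let ?z = "(\<chi> i. of_int \<lfloor>x $ i\<rfloor>) :: real^'n"
  show "x - ?z \<in> cbox 0 1" by (auto simp: mem_box_cart) linarith
  show "tor_eq x (x - ?z)" by (simp add: tor_eq_def int_vec_def)
qed

lemma range_periodic_fun: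
  fixes u :: "real^'n \<Rightarrow> 'b"
  assumes "periodic_fun u"
  shows "range u = u ` cbox 0 1"
proof -
  have "u x \<in> u ` cbox 0 1" for x
  proof -
    obtain y where "y \<in> cbox 0 1" "tor_eq x y" by (rule tor_eq_unit_cube)
    then show ?thesis using periodic_fun_tor_eq[OF assms] by blast
  qed
  then show ?thesis by auto
qed

lemma compact_range_periodic_fun:
  fixes u :: "real^'n \<Rightarrow> 'b::topological_space"
  assumes "continuous_on UNIV u" "periodic_fun u"
  shows "compact (range u)"
  unfolding range_periodic_fun[OF assms(2)]
  by (intro compact_continuous_image continuous_on_subset[OF assms(1)]) auto

lemma periodic_attains_max:
  fixes u :: "real^'n \<Rightarrow> real"
  assumes "continuous_on UNIV u" "periodic_fun u"
  obtains x0 where "\<And>x. u x \<le> u x0"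
  using compact_attains_sup[OF compact_range_periodic_fun[OF assms]] by auto

lemma closed_int_vec: "closed {z::real^'n. int_vec z}"
proof -
  have "{z::real^'n. int_vec z} = (\<Inter>i. (\<lambda>z. z $ i) -` \<int>)" by (auto simp: int_vec_def)
  moreover have "closed ((\<lambda>z::real^'n. z $ i) -` \<int>)" for i
    by (intro closed_vimage closed_Ints continuous_intros)
  ultimately show ?thesis by auto
qed

lemma int_vec_norm_less_1_imp_0:
  fixes z :: "real^'n"
  assumes "int_vec z" "norm z < 1"
  shows "z = 0"
proof (rule ccontr)
  assume "z \<noteq> 0"
  then obtain i where i: "z $ i \<noteq> 0" by (auto simp: vec_eq_iff)
  have "1 \<le> \<bar>z $ i\<bar>" using assms(1) i by (intro Ints_nonzero_abs_ge1) (auto simp: int_vec_def)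
  then show False using component_le_norm_cart[of z i] assms(2) by simp
qed

lemma has_derivative_tor_eq:
  fixes v :: "real^'n \<Rightarrow> 'b::real_normed_vector"
  assumes "(v has_derivative L) (at x)" "periodic_fun v" "tor_eq y x"
  shows "(v has_derivative L) (at y)"
proof -
  have shift: "((\<lambda>w. w - (y - x)) has_derivative (\<lambda>k. k)) (at y)"
    by (auto intro!: derivative_eq_intros)
  have "((\<lambda>w. v (w - (y - x))) has_derivative L) (at y)"
    by (rule has_derivative_compose[OF shift]) (simp add: assms(1))
  moreover have "v (w - (y - x)) = v w" for w
    using tor_eq_sym[OF assms(3)] by (intro periodic_fun_tor_eq[OF assms(2)]) (simp add: tor_eq_def)
  ultimately show ?thesis by simp
qed

lemma bounded_image_periodic_strip:
  fixes F :: "(real^'n) \<times> 'a::heine_borel \<Rightarrow> 'b::real_normed_vector"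
  assumes "continuous_on UNIV F" "\<And>p. periodic_fun (\<lambda>x. F (x, p))" "compact P"
  shows "bounded (F ` (UNIV \<times> P))"
proof -
  have "F ` (UNIV \<times> P) \<subseteq> F ` (cbox 0 1 \<times> P)"
  proof (clarify intro!: image_subsetI)
    fix x :: "real^'n" and p assume "p \<in> P"
    obtain y where "y \<in> cbox 0 1" "tor_eq x y" by (rule tor_eq_unit_cube)
    then show "F (x, p) \<in> F ` (cbox 0 1 \<times> P)"
      using periodic_fun_tor_eq[OF assms(2)] \<open>p \<in> P\<close> by blast
  qed
  moreover have "compact (F ` (cbox 0 1 \<times> P))"
    by (intro compact_continuous_image continuous_on_subset[OF assms(1)] compact_Times assms(3)) auto
  ultimately show ?thesis using bounded_subset compact_imp_bounded by blast
qed

section \<open>Hamiltonian flow\<close>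

lemma gradient_unique:
  fixes g g' :: "'a::real_inner"
  assumes "(f has_derivative (\<lambda>k. g \<bullet> k)) (at x)" "(f has_derivative (\<lambda>k. g' \<bullet> k)) (at x)"
  shows "g = g'"
  using has_derivative_unique[OF assms] by (metis vector_eq_rdot)

lemma tonelli_sublevel_bounded:
  assumes "tonelli H"
  obtains R where "0 < R" "\<And>x p. H x p \<le> E \<Longrightarrow> norm p \<le> R"
proof -
  obtain R where R: "\<And>x p. norm p \<ge> R \<Longrightarrow> H x p \<ge> 1 * norm p"
    using assms unfolding tonelli_def by metis
  have "norm p \<le> \<bar>R\<bar> + \<bar>E\<bar> + 1" if "H x p \<le> E" for x p
    using R[of p x] that by linarith
  moreover have "0 < \<bar>R\<bar> + \<bar>E\<bar> + 1" by linarith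
  ultimately show ?thesis using that by blast
qed

locale C2_hamiltonian =
  fixes H :: "real^'n \<Rightarrow> real^'n \<Rightarrow> real" and G G'
  assumes tonelli: "tonelli H"
    and G: "\<And>z. ((\<lambda>z. H (fst z) (snd z)) has_derivative (\<lambda>k. G z \<bullet> k)) (at z)"
    and G': "\<And>z. (G has_derivative blinfun_apply (G' z)) (at z)"
    and continuous_G': "continuous_on UNIV G'"
begin

lemma continuous_H: "continuous_on UNIV (\<lambda>z. H (fst z) (snd z))"
  using G by (meson has_derivative_continuous_on has_derivative_at_withinI)

lemma gradient_momentum: "((\<lambda>q. H x q) has_derivative (\<lambda>k. snd (G (x, p)) \<bullet> k)) (at p)"
proof -
  have "((\<lambda>q. (x, q)) has_derivative (\<lambda>k. (0, k))) (at p)" by (auto intro!: derivative_eq_intros)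
  from has_derivative_compose[OF this G] show ?thesis by (simp add: inner_prod_def)
qed

lemma gradient_position: "((\<lambda>y. H y p) has_derivative (\<lambda>k. fst (G (x, p)) \<bullet> k)) (at x)"
proof -
  have "((\<lambda>y. (y, p)) has_derivative (\<lambda>k. (k, 0))) (at x)" by (auto intro!: derivative_eq_intros)
  from has_derivative_compose[OF this G] show ?thesis by (simp add: inner_prod_def)
qed

lemma Hp_eq: "Hp H x p = snd (G (x, p))"
  unfolding Hp_def using gradient_momentum gradient_unique by (intro the_equality) blast+

lemma Hx_eq: "Hx H x p = fst (G (x, p))"
  unfolding Hx_def using gradient_position gradient_unique by (intro the_equality) blast+

lemma has_derivative_Hp: "((\<lambda>q. Hp H x q) has_derivative Hpp H x p) (at p)"
proof -
  have "((\<lambda>q. (x, q)) has_derivative (\<lambda>k. (0, k))) (at p)" by (auto intro!: derivative_eq_intros)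
  from has_derivative_snd[OF has_derivative_compose[OF this G']]
  have deriv: "((\<lambda>q. Hp H x q) has_derivative (\<lambda>k. snd (blinfun_apply (G' (x, p)) (0, k)))) (at p)"
    by (simp add: Hp_eq)
  then have "Hpp H x p = (\<lambda>k. snd (blinfun_apply (G' (x, p)) (0, k)))"
    unfolding Hpp_def using has_derivative_unique by (intro the_equality) blast+
  then show ?thesis using deriv by simp
qed

lemma convex_in_momentum: "H x p + Hp H x p \<bullet> (q - p) \<le> H x q"
proof -
  define l where "l t = p + t *\<^sub>R (q - p)" for t :: real
  have l: "(l has_derivative (\<lambda>h. h *\<^sub>R (q - p))) (at t)" for t
    unfolding l_def[abs_def] by (auto intro!: derivative_eq_intros)
  have first: "((\<lambda>t. H x (l t)) has_real_derivative Hp H x (l t) \<bullet> (q - p)) (at t)" for t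
    using has_derivative_compose[OF l gradient_momentum[unfolded Hp_eq[symmetric]]]
    by (simp add: has_field_derivative_def mult_commute_abs)
  have second: "((\<lambda>t. Hp H x (l t) \<bullet> (q - p)) has_real_derivative
      Hpp H x (l t) (q - p) \<bullet> (q - p)) (at t)" for t
  proof -
    have linear: "linear (Hpp H x (l t))" using has_derivative_Hp has_derivative_linear by blast
    have "((\<lambda>t. Hp H x (l t)) has_derivative (\<lambda>h. h *\<^sub>R Hpp H x (l t) (q - p))) (at t)"
      using has_derivative_compose[OF l[of t] has_derivative_Hp[of x "l t"]]
      by (simp add: linear_scale[OF linear])
    from has_derivative_inner_left[OF this, of "q - p"] show ?thesis
      by (simp add: has_field_derivative_def mult_commute_abs)
  qed
  have nonneg: "0 \<le> Hpp H x (l t) (q - p) \<bullet> (q - p)" for t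
    using tonelli unfolding tonelli_def
    by (cases "q - p = 0") (auto intro: less_imp_le)
  have "(Hp H x (l 0) \<bullet> (q - p)) * (1 - 0) \<le> H x (l 1) - H x (l 0)"
    using first second nonneg by (rule f''_imp_f'[OF convex_UNIV]) auto
  then show ?thesis by (simp add: l_def)
qed

lemma periodic_G: "periodic_fun (\<lambda>x. G (x, p))"
  unfolding periodic_fun_def
proof (intro allI impI)
  fix x z :: "real^'n" assume z: "int_vec z"
  have "((\<lambda>w. w + (z, 0)) has_derivative (\<lambda>k. k)) (at (x, p))"
    by (auto intro!: derivative_eq_intros)
  from has_derivative_compose[OF this G]
  have "((\<lambda>w. H (fst w) (snd w)) has_derivative (\<lambda>k. G (x + z, p) \<bullet> k)) (at (x, p))"
    using tonelli z by (simp add: tonelli_def periodic_fun_def)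
  then show "G (x + z, p) = G (x, p)" using G gradient_unique by blast
qed

lemma periodic_G': "periodic_fun (\<lambda>x. G' (x, p))"
  unfolding periodic_fun_def
proof (intro allI impI)
  fix x z :: "real^'n" assume z: "int_vec z"
  have shift: "((\<lambda>w. w + (z, 0)) has_derivative (\<lambda>k. k)) (at (x, p))"
    by (auto intro!: derivative_eq_intros)
  have "(\<lambda>w. G (w + (z, 0))) = G" using periodic_G z by (auto simp: fun_eq_iff periodic_fun_def)
  then have "(G has_derivative blinfun_apply (G' (x + z, p))) (at (x, p))"
    using has_derivative_compose[OF shift G'] by simp
  then have "blinfun_apply (G' (x + z, p)) = blinfun_apply (G' (x, p))"
    using G' has_derivative_unique by blast
  then show "G' (x + z, p) = G' (x, p)" by (simp add: blinfun_apply_inject)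
qed

definition ham_field :: "(real^'n) \<times> (real^'n) \<Rightarrow> (real^'n) \<times> (real^'n)" where
  "ham_field w = (snd (G w), - fst (G w))"

lemma ham_traj_iff: "ham_traj H \<gamma> \<longleftrightarrow> (\<forall>s. (\<gamma> has_vector_derivative ham_field (\<gamma> s)) (at s))"
  by (simp add: ham_traj_def Hp_eq Hx_eq ham_field_def)

lemma inner_gradient_ham_field: "G w \<bullet> ham_field w = 0"
  by (simp add: ham_field_def inner_prod_def inner_commute)

lemma ham_field_bounded_lipschitz_on_strip:
  obtains L B where "L-lipschitz_on (UNIV \<times> cball 0 r) ham_field"
    "\<And>w. w \<in> UNIV \<times> cball 0 r \<Longrightarrow> norm (ham_field w) \<le> B"
proof -
  let ?S = "UNIV \<times> cball 0 r :: ((real^'n) \<times> (real^'n)) set"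
  have "continuous_on UNIV G" using G'
    by (meson has_derivative_continuous_on has_derivative_at_withinI)
  then have "bounded (G ` ?S)" by (rule bounded_image_periodic_strip[OF _ periodic_G]) simp
  then obtain B where B: "\<And>w. w \<in> ?S \<Longrightarrow> norm (G w) \<le> B" unfolding bounded_iff by blast
  have "bounded (G' ` ?S)" by (rule bounded_image_periodic_strip[OF continuous_G' periodic_G']) simp
  then obtain L where L: "0 < L" "\<And>w. w \<in> ?S \<Longrightarrow> norm (G' w) \<le> L" unfolding bounded_pos by blast
  have "L-lipschitz_on ?S G"
    by (rule bounded_derivative_imp_lipschitz[where f' = "\<lambda>w. blinfun_apply (G' w)"])
       (use L in \<open>auto intro!: has_derivative_at_withinI G' convex_Times
          simp: norm_blinfun.rep_eq[symmetric]\<close>)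
  then have "L-lipschitz_on ?S ham_field"
    by (simp add: lipschitz_on_def ham_field_def dist_norm norm_prod_def add.commute
        norm_minus_commute)
  moreover have "norm (ham_field w) \<le> B" if "w \<in> ?S" for w
    using B[OF that] by (simp add: ham_field_def norm_prod_def add.commute)
  ultimately show ?thesis by (rule that)
qed

lemma ham_traj_exists_unique: "\<exists>!\<gamma>. ham_traj H \<gamma> \<and> \<gamma> 0 = z"
proof -
  let ?E = "\<lambda>w. H (fst w) (snd w)"
  obtain r where r: "\<And>x p. H x p \<le> ?E z \<Longrightarrow> norm p \<le> r"
    using tonelli_sublevel_bounded[OF tonelli] by blast
  let ?S = "UNIV \<times> cball 0 (r + 1) :: ((real^'n) \<times> (real^'n)) set"
  obtain L B where field: "L-lipschitz_on ?S ham_field"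
    "\<And>w. w \<in> ?S \<Longrightarrow> norm (ham_field w) \<le> B"
    by (rule ham_field_bounded_lipschitz_on_strip) blast
  define \<kappa> where "\<kappa> w = max 0 (min 1 (r + 1 - norm (snd w)))" for w :: "(real^'n) \<times> (real^'n)"
  have cutoff: "1-lipschitz_on UNIV \<kappa>"
  proof (rule lipschitz_onI)
    fix w w' :: "(real^'n) \<times> (real^'n)"
    have "\<bar>\<kappa> w - \<kappa> w'\<bar> \<le> \<bar>norm (snd w) - norm (snd w')\<bar>" unfolding \<kappa>_def by linarith
    also have "\<dots> \<le> norm (snd (w - w'))" unfolding snd_diff by (rule norm_triangle_ineq3)
    also have "\<dots> \<le> norm (w - w')" using norm_snd_le[of "snd (w - w')" "fst (w - w')"]
      by (simp only: prod.collapse)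
    finally show "dist (\<kappa> w) (\<kappa> w') \<le> 1 * dist w w'" by (simp add: dist_norm)
  qed simp
  have "\<exists>!\<gamma>. (\<forall>s. (\<gamma> has_vector_derivative ham_field (\<gamma> s)) (at s)) \<and> \<gamma> 0 = z"
  proof (rule conserved_energy_unique_orbit[OF G inner_gradient_ham_field _ _ _ field(1) _ cutoff])
    show "convex ?S" by (intro convex_Times) simp_all
    show "closed ?S" by (intro closed_Times) simp_all
    have "norm (snd z) \<le> r" using r[of "fst z" "snd z"] by simp
    then show "z \<in> ?S" by (simp add: mem_Times_iff)
    show "norm (ham_field w) \<le> B" if "w \<in> ?S" for w
      by (rule field(2)[OF that])
    show "\<bar>\<kappa> w\<bar> \<le> 1" for w by (simp add: \<kappa>_def)
    show "\<kappa> w = 0" if "w \<notin> ?S" for w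
      using that by (auto simp: \<kappa>_def mem_Times_iff)
    show "\<kappa> w = 1" if "?E w = ?E z" for w
      using r[of "fst w" "snd w"] that by (simp add: \<kappa>_def)
  qed
  then show ?thesis by (simp add: ham_traj_iff)
qed

lemma ham_flow_traj: "ham_traj H (\<lambda>s. ham_flow H s z)" and ham_flow_0: "ham_flow H 0 z = z"
  using theI'[OF ham_traj_exists_unique[of z]] by (simp_all add: ham_flow_def)

end

lemma tonelli_imp_C2_hamiltonian:
  assumes "tonelli H"
  obtains G G' where "C2_hamiltonian H G G'"
proof -
  have "C2_fun (\<lambda>z. H (fst z) (snd z))" using assms by (simp add: tonelli_def)
  then obtain G G' where "C2_hamiltonian H G G'"
    using assms unfolding C2_hamiltonian_def C2_fun_def by blast
  then show ?thesis by (rule that)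
qed

section \<open>Regularity of invariant graphs\<close>

lemma C1_map_lipschitz_on_bounded:
  fixes f :: "'a::euclidean_space \<Rightarrow> 'b::real_normed_vector"
  assumes "C1_map f" "bounded S"
  obtains L where "0 < L" "L-lipschitz_on S f"
proof -
  obtain f' where f': "\<And>y. (f has_derivative blinfun_apply (f' y)) (at y)" "continuous_on UNIV f'"
    using assms(1) unfolding C1_map_def by blast
  obtain r where r: "S \<subseteq> cball 0 r" using bounded_subset_ballD[OF assms(2), of 0] ball_subset_cball
    by blast
  have "bounded (f' ` cball 0 r)"
    by (intro compact_imp_bounded compact_continuous_image continuous_on_subset[OF f'(2)]) auto
  then obtain L where L: "0 < L" "\<And>y. y \<in> cball 0 r \<Longrightarrow> norm (f' y) \<le> L"
    unfolding bounded_pos by blast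
  have "L-lipschitz_on (cball 0 r) f"
    by (rule bounded_derivative_imp_lipschitz[where f' = "\<lambda>y. blinfun_apply (f' y)"])
       (use L in \<open>auto intro!: has_derivative_at_withinI f' simp: norm_blinfun.rep_eq[symmetric]\<close>)
  then show ?thesis using that L(1) r lipschitz_on_subset by blast
qed

locale torus_graph =
  fixes c :: "real^'n" and v :: "real^'n \<Rightarrow> real" and \<phi> \<psi> :: "real^'n \<Rightarrow> real^'n"
  assumes embedding: "torus_embedding \<phi> \<psi> (graph_c c v)" and C1_\<phi>: "C1_map \<phi>" and C1_\<psi>: "C1_map \<psi>"
    and periodic: "periodic_fun v"
begin

lemma continuous_chart: "continuous_on S \<phi>" "continuous_on S \<psi>"
  using C1_\<phi> C1_\<psi> unfolding C1_map_def
  by (meson has_derivative_continuous_on has_derivative_at_withinI)+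

lemma \<phi>_tor_eq:
  assumes "tor_eq \<theta> \<theta>'"
  shows "tor_eq (\<phi> \<theta>) (\<phi> \<theta>')"
proof -
  have "int_vec (\<phi> (\<theta>' + (\<theta> - \<theta>')) - \<phi> \<theta>')"
    using embedding assms unfolding torus_embedding_def tor_eq_def by blast
  then show ?thesis by (simp add: tor_eq_def)
qed

lemma gradient_at:
  assumes "tor_eq x (\<phi> \<theta>)"
  shows "(v has_derivative (\<lambda>k. (\<psi> \<theta> - c) \<bullet> k)) (at x)"
proof -
  have "(\<phi> \<theta>, \<psi> \<theta>) \<in> graph_c c v" using embedding by (simp add: torus_embedding_def)
  then have "(v has_derivative (\<lambda>k. (\<psi> \<theta> - c) \<bullet> k)) (at (\<phi> \<theta>))" by (auto simp: graph_c_def)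
  then show ?thesis using periodic assms by (rule has_derivative_tor_eq)
qed

lemma inj_on_\<phi>_ball: "inj_on \<phi> (ball a (1/2))"
proof (rule inj_onI)
  fix \<theta> \<theta>' assume \<theta>: "\<theta> \<in> ball a (1/2)" "\<theta>' \<in> ball a (1/2)" and eq: "\<phi> \<theta> = \<phi> \<theta>'"
  have "\<psi> \<theta> - c = \<psi> \<theta>' - c"
    by (rule gradient_unique[of v _ "\<phi> \<theta>"]) (auto intro!: gradient_at simp: eq tor_eq_refl)
  then have "\<psi> \<theta> = \<psi> \<theta>'" by simp
  then have "tor_eq \<theta> \<theta>'"
    using embedding eq tor_eq_refl[of "\<phi> \<theta>"] unfolding torus_embedding_def by metis
  moreover have "norm (\<theta> - \<theta>') < 1"
    using \<theta> dist_triangle_half_r[of a \<theta> 1 \<theta>'] by (simp add: dist_norm)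
  ultimately have "\<theta> - \<theta>' = 0" unfolding tor_eq_def by (rule int_vec_norm_less_1_imp_0)
  then show "\<theta> = \<theta>'" by simp
qed

lemma open_image_\<phi>:
  assumes "open S"
  shows "open (\<phi> ` S)"
proof -
  have "\<phi> ` S = (\<Union>a\<in>S. \<phi> ` (ball a (1/2) \<inter> S))" by (auto intro!: imageI)
  moreover have "open (\<phi> ` (ball a (1/2) \<inter> S))" for a
    using assms inj_on_\<phi>_ball continuous_chart(1)
    by (intro invariance_of_domain) (auto intro: inj_on_subset)
  ultimately show ?thesis by auto
qed

lemma saturation_eq_translates:
  "{x. \<exists>\<theta>\<in>S. tor_eq x (\<phi> \<theta>)} = (\<Union>y\<in>\<phi> ` S. \<Union>z\<in>{z. int_vec z}. {y + z})" (is "?L = ?R")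
proof (intro set_eqI iffI)
  fix x assume "x \<in> ?L"
  then obtain \<theta> where "\<theta> \<in> S" "int_vec (x - \<phi> \<theta>)" by (auto simp: tor_eq_def)
  moreover have "x = \<phi> \<theta> + (x - \<phi> \<theta>)" by simp
  ultimately show "x \<in> ?R" by blast
next
  fix x assume "x \<in> ?R"
  then obtain \<theta> z where "\<theta> \<in> S" "int_vec z" "x = \<phi> \<theta> + z" by blast
  then show "x \<in> ?L" by (auto simp: tor_eq_def intro!: bexI[of _ \<theta>])
qed

lemma open_saturation:
  assumes "open S"
  shows "open {x. \<exists>\<theta>\<in>S. tor_eq x (\<phi> \<theta>)}"
proof -
  have "{x. \<exists>\<theta>\<in>S. tor_eq x (\<phi> \<theta>)} = (\<Union>z\<in>{z. int_vec z}. (+) z ` (\<phi> ` S))"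
    unfolding saturation_eq_translates by (auto simp: add.commute)
  then show ?thesis using open_image_\<phi>[OF assms] by (auto intro!: open_translation)
qed

lemma \<phi>_surj_mod:
  obtains \<theta> where "\<theta> \<in> cbox 0 1" "tor_eq x (\<phi> \<theta>)"
proof -
  let ?U = "{x. \<exists>\<theta>\<in>UNIV. tor_eq x (\<phi> \<theta>)}"
  have cube: "?U = {x. \<exists>\<theta>\<in>cbox 0 1. tor_eq x (\<phi> \<theta>)}"
    by (metis UNIV_I \<phi>_tor_eq tor_eq_trans tor_eq_unit_cube)
  have "closed ?U" unfolding cube saturation_eq_translates
    by (intro compact_closed_sums compact_continuous_image closed_int_vec continuous_chart) auto
  moreover have "open ?U" by (rule open_saturation) auto
  moreover have "\<phi> 0 \<in> ?U" using tor_eq_refl by blast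
  ultimately have "?U = UNIV" using clopen[of ?U] by auto
  then show ?thesis using that cube by blast
qed

lemma \<phi>_lipschitz_near_cube:
  obtains L where "0 < L"
    "\<And>\<theta> e. \<theta> \<in> cbox 0 1 \<Longrightarrow> norm e \<le> 1 \<Longrightarrow> norm (\<phi> \<theta> - \<phi> (\<theta> + e)) \<le> L * norm e"
proof -
  have "bounded (cbox 0 (1::real^'n))" by simp
  then obtain r where r: "\<And>\<theta>::real^'n. \<theta> \<in> cbox 0 1 \<Longrightarrow> norm \<theta> \<le> r" unfolding bounded_iff by blast
  obtain L where L: "0 < L" "L-lipschitz_on (cball 0 (r + 1)) \<phi>"
    using C1_map_lipschitz_on_bounded[OF C1_\<phi> bounded_cball] .
  have "norm (\<phi> \<theta> - \<phi> (\<theta> + e)) \<le> L * norm e" if "\<theta> \<in> cbox 0 1" "norm e \<le> 1" for \<theta> e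
    using lipschitz_on_normD[OF L(2), of \<theta> "\<theta> + e"] r[OF that(1)] that(2) norm_triangle_ineq[of \<theta> e]
    by simp
  then show ?thesis using that L(1) by blast
qed

text \<open>Invariance of domain makes the chart \<open>\<phi>\<close> open modulo integer translations, so that the
  continuity of \<open>\<psi>\<close> descends to \<open>v\<^sub>x = \<psi> \<circ> \<phi>\<^sup>-\<^sup>1 - c\<close>.\<close>

lemma graph_function_C1:
  obtains g where "C1_test v g"
proof -
  have "\<exists>\<theta>. tor_eq x (\<phi> \<theta>)" for x using \<phi>_surj_mod by blast
  then obtain \<Theta> where \<Theta>: "\<And>x. tor_eq x (\<phi> (\<Theta> x))" by metis
  define g where "g x = \<psi> (\<Theta> x) - c" for x
  have g: "(v has_derivative (\<lambda>k. g x \<bullet> k)) (at x)" for x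
    unfolding g_def by (rule gradient_at[OF \<Theta>])
  have g_eq: "g x = \<psi> \<theta> - c" if "tor_eq x (\<phi> \<theta>)" for x \<theta>
    using gradient_unique[OF g gradient_at[OF that]] .
  have "open (g -` W)" if "open W" for W
  proof -
    have "open ((\<lambda>\<theta>. \<psi> \<theta> - c) -` W)" by (intro open_vimage that continuous_intros continuous_chart)
    then have "open {x. \<exists>\<theta>\<in>(\<lambda>\<theta>. \<psi> \<theta> - c) -` W. tor_eq x (\<phi> \<theta>)}" by (rule open_saturation)
    moreover have "{x. \<exists>\<theta>\<in>(\<lambda>\<theta>. \<psi> \<theta> - c) -` W. tor_eq x (\<phi> \<theta>)} = g -` W"
      using g_eq \<Theta> by force
    ultimately show ?thesis by simp
  qed
  then have "continuous_on UNIV g" by (simp add: continuous_on_open_vimage)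
  then show ?thesis using g that[of g] by (simp add: C1_test_def)
qed

end

section \<open>Rate of convergence\<close>

lemma discounted_solution_bound:
  fixes H :: "real^'n \<Rightarrow> real^'n \<Rightarrow> real"
  assumes v: "C1_test v g" "\<And>x. H x (c + g x) = hc" "periodic_fun v" "\<And>x. \<bar>v x\<bar> \<le> B"
    and \<epsilon>: "0 < \<epsilon>" and u: "viscosity_solution (\<lambda>x r p. \<epsilon> * r + H x (c + p) - hc) u"
  shows "\<bar>u x\<bar> \<le> 2 * B"
proof -
  note cont = viscosity_solution_continuous[OF u] continuous_on_C1_test[OF v(1)]
  note periodic = viscosity_solution_periodic[OF u] v(3)
  obtain x0 where x0: "\<And>x. u x - v x \<le> u x0 - v x0"
  proof (rule periodic_attains_max[of "\<lambda>x. u x - v x"])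
    show "periodic_fun (\<lambda>x. u x - v x)" using periodic by (simp add: periodic_fun_def)
  qed (use cont in \<open>auto intro: continuous_on_diff\<close>)
  have "\<epsilon> * u x0 \<le> 0" using viscosity_solution_superdiff[OF u superdiffI[OF v(1) x0]] v(2) by simp
  then have "u x0 \<le> 0" using \<epsilon> by (simp add: mult_le_0_iff)
  moreover obtain x1 where x1: "\<And>x. v x - u x \<le> v x1 - u x1"
  proof (rule periodic_attains_max[of "\<lambda>x. v x - u x"])
    show "periodic_fun (\<lambda>x. v x - u x)" using periodic by (simp add: periodic_fun_def)
  qed (use cont in \<open>auto intro: continuous_on_diff\<close>)
  have "g x1 \<in> subdiff u x1" by (rule subdiffI[OF v(1)]) (use x1 in \<open>simp add: algebra_simps\<close>)
  then have "0 \<le> \<epsilon> * u x1" using viscosity_solution_subdiff[OF u] v(2) by fastforce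
  then have "0 \<le> u x1" using \<epsilon> by (simp add: zero_le_mult_iff)
  ultimately show ?thesis
    using x0[of x] x1[of x] v(4)[of x] v(4)[of x0] v(4)[of x1] by (simp add: abs_le_iff)
qed

lemma discounted_hj_subsolution:
  assumes u: "viscosity_solution (\<lambda>x r p. \<epsilon> * r + H x (c + p) - hc) u" "\<And>x. \<bar>u x\<bar> \<le> K" and "0 \<le> \<epsilon>"
  shows "hj_subsolution (\<lambda>x p. H x (c + p)) (hc + \<epsilon> * K) u"
  unfolding hj_subsolution_def
proof (intro allI ballI)
  fix x p assume "p \<in> superdiff u x"
  then have "\<epsilon> * u x + H x (c + p) - hc \<le> 0" by (rule viscosity_solution_superdiff[OF u(1)])
  moreover have "\<epsilon> * (- u x) \<le> \<epsilon> * K" using u(2)[of x] \<open>0 \<le> \<epsilon>\<close>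
    by (intro mult_left_mono) (auto simp: abs_le_iff)
  ultimately show "H x (c + p) \<le> hc + \<epsilon> * K" by simp
qed

lemma tonelli_subsolution_lipschitz:
  fixes H :: "real^'n \<Rightarrow> real^'n \<Rightarrow> real"
  assumes "tonelli H"
  obtains R where "0 < R"
    "\<And>u B k'. continuous_on UNIV u \<Longrightarrow> (\<And>x. \<bar>u x\<bar> \<le> B) \<Longrightarrow> k' \<le> k \<Longrightarrow>
      hj_subsolution (\<lambda>x p. H x (c + p)) k' u \<Longrightarrow> R-lipschitz_on UNIV u"
proof -
  obtain R where R: "0 < R" "\<And>x p. H x p \<le> k \<Longrightarrow> norm p \<le> R"
    using tonelli_sublevel_bounded[OF assms] by blast
  have "(R + norm c)-lipschitz_on UNIV u"
    if "continuous_on UNIV u" "\<And>x. \<bar>u x\<bar> \<le> B" "k' \<le> k" "hj_subsolution (\<lambda>x p. H x (c + p)) k' u"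
      for u B k'
  proof (rule superdiff_bound_imp_lipschitz[OF that(1,2)])
    fix x p assume "p \<in> superdiff u x"
    then have "norm (c + p) \<le> R" using that(3,4) unfolding hj_subsolution_def
      by (intro R(2)[of x]) force
    then show "norm p \<le> R + norm c" using norm_triangle_ineq4[of "c + p" c] by simp
  qed (use R(1) in simp)
  moreover have "0 < R + norm c" using R(1) by (simp add: add_pos_nonneg)
  ultimately show ?thesis using that by blast
qed

lemma in_graph_c_gradient: "C1_test v g \<Longrightarrow> (x, c + g x) \<in> graph_c c v"
  by (auto simp: C1_test_def graph_c_def)

locale kam_solution =
  fixes H :: "real^'n \<Rightarrow> real^'n \<Rightarrow> real" and c :: "real^'n" and hc :: real and v :: "real^'n \<Rightarrow> real"
    and \<nu> \<eta> :: real and \<omega> :: "real^'n"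
  assumes tonelli_H: "tonelli H"
    and solution: "viscosity_solution (\<lambda>x r p. H x (c + p) - hc) v"
    and KAM: "KAM_torus H c v \<nu> \<eta> \<omega>"
begin

abbreviation discounted_solution :: "real \<Rightarrow> (real^'n \<Rightarrow> real) \<Rightarrow> bool" where
  "discounted_solution \<epsilon> u \<equiv> viscosity_solution (\<lambda>x r p. \<epsilon> * r + H x (c + p) - hc) u"

definition characteristic :: "(real^'n \<Rightarrow> real^'n) \<Rightarrow> real \<Rightarrow> real^'n \<Rightarrow> real^'n" where
  "characteristic g s x = fst (ham_flow H s (x, c + g x))"

lemma diophantine_frequency: "diophantine \<nu> \<eta> \<omega>"
  using KAM by (simp add: KAM_torus_def)

lemma conjugating_chart:
  obtains \<phi> \<psi> where "torus_graph c v \<phi> \<psi>"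
    "\<And>z. z \<in> graph_c c v \<Longrightarrow> \<exists>\<theta>0. \<forall>s. tor_eq (fst (ham_flow H s z)) (\<phi> (s *\<^sub>R \<omega> + \<theta>0))"
  using KAM viscosity_solution_periodic[OF solution] unfolding KAM_torus_def torus_graph_def
  by blast

lemma classical_solution:
  obtains g where "C1_test v g" "\<And>x. H x (c + g x) = hc"
proof -
  obtain \<phi> \<psi> where "torus_graph c v \<phi> \<psi>" by (rule conjugating_chart)
  then obtain g where "C1_test v g" by (rule torus_graph.graph_function_C1)
  moreover from viscosity_solution_classical[OF solution this] have "H x (c + g x) = hc" for x
    by simp
  ultimately show ?thesis by (rule that)
qed

lemma characteristic_ode:
  assumes g: "C1_test v g"
  shows "characteristic g 0 x = x"
    and "((\<lambda>s. characteristic g s x) has_vector_derivative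
      Hp H (characteristic g s x) (c + g (characteristic g s x))) (at s)"
proof -
  obtain G G' where "C2_hamiltonian H G G'" using tonelli_imp_C2_hamiltonian[OF tonelli_H] .
  then interpret C2_hamiltonian H G G' .
  let ?z = "(x, c + g x)" and ?X = "\<lambda>s. characteristic g s x"
  have grad: "(v has_derivative (\<lambda>k. g y \<bullet> k)) (at y)" for y using g by (simp add: C1_test_def)
  have invariant: "ham_flow H s ?z \<in> graph_c c v" for s
    using KAM in_graph_c_gradient[OF g] by (simp add: KAM_torus_def)
  have momentum: "snd (ham_flow H s ?z) = c + g (?X s)" for s
  proof -
    obtain y p where flow: "ham_flow H s ?z = (y, c + p)" "(v has_derivative (\<lambda>k. p \<bullet> k)) (at y)"
      using invariant[of s] unfolding graph_c_def by blast
    then show ?thesis using gradient_unique[OF grad flow(2)] by (simp add: characteristic_def)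
  qed
  show "?X 0 = x" by (simp add: characteristic_def ham_flow_0)
  have "((\<lambda>s. ham_flow H s ?z) has_vector_derivative
      (Hp H (?X s) (c + g (?X s)), - Hx H (?X s) (c + g (?X s)))) (at s)"
    using ham_flow_traj[of ?z] unfolding ham_traj_def momentum by (simp add: characteristic_def)
  from bounded_linear.has_vector_derivative[OF bounded_linear_fst this]
  show "(?X has_vector_derivative Hp H (?X s) (c + g (?X s))) (at s)"
    by (simp add: characteristic_def)
qed

lemma subsolution_growth_along_characteristic:
  assumes g: "C1_test v g" "\<And>x. H x (c + g x) = hc"
    and u: "R-lipschitz_on UNIV u" "\<And>x. \<bar>u x\<bar> \<le> B" "hj_subsolution (\<lambda>x p. H x (c + p)) (hc + a) u"
    and s: "0 \<le> s"
  shows "u (characteristic g s x) - v (characteristic g s x) \<le> u x - v x + a * s"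
proof -
  obtain G G' where "C2_hamiltonian H G G'" using tonelli_imp_C2_hamiltonian[OF tonelli_H] .
  then interpret C2_hamiltonian H G G' .
  let ?X = "\<lambda>s. characteristic g s x"
  have "u (?X s) - v (?X s) \<le> u (?X 0) - v (?X 0) + ((hc + a) - hc) * s"
  proof (rule subsolution_along_characteristic[OF _ _ u])
    show "continuous_on UNIV (\<lambda>z. H (fst z) (c + snd z))"
      by (rule continuous_on_compose2[OF continuous_H, of _ "\<lambda>z. (fst z, c + snd z)", simplified])
         (intro continuous_intros)
    show "H x (c + p) + Hp H x (c + p) \<bullet> (q - p) \<le> H x (c + q)" for x p q
      using convex_in_momentum[of x "c + p" "c + q"] by simp
    show "(?X has_vector_derivative Hp H (?X s) (c + g (?X s))) (at s)" for s
      by (rule characteristic_ode(2)[OF g(1)])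
  qed (use g s in \<open>auto simp: C1_test_def\<close>)
  then show ?thesis by (simp add: characteristic_ode(1)[OF g(1)])
qed

lemma characteristics_dense:
  assumes g: "C1_test v g"
  obtains C where "0 < C"
    "\<And>\<delta> x y. 0 < \<delta> \<Longrightarrow> \<delta> \<le> 1 \<Longrightarrow> \<exists>s\<in>{0..C * \<delta> powr (- (2 * \<eta>))}.
      \<exists>y'. tor_eq y' y \<and> norm (y' - characteristic g s x) \<le> C * \<delta>"
proof -
  obtain \<phi> \<psi> where "torus_graph c v \<phi> \<psi>" and conj: "\<And>z. z \<in> graph_c c v \<Longrightarrow>
      \<exists>\<theta>0. \<forall>s. tor_eq (fst (ham_flow H s z)) (\<phi> (s *\<^sub>R \<omega> + \<theta>0))"
    by (rule conjugating_chart) blast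
  then interpret torus_graph c v \<phi> \<psi> by simp
  obtain L where L: "0 < L"
    "\<And>\<theta> e. \<theta> \<in> cbox 0 1 \<Longrightarrow> norm e \<le> 1 \<Longrightarrow> norm (\<phi> \<theta> - \<phi> (\<theta> + e)) \<le> L * norm e"
    using \<phi>_lipschitz_near_cube by blast
  obtain C where C: "0 < C" and dense: "\<And>\<delta> x. 0 < \<delta> \<Longrightarrow> \<delta> \<le> 1 \<Longrightarrow>
      \<exists>s\<in>{0..C * \<delta> powr (- (2 * \<eta>))}. \<exists>z. int_vec z \<and> norm (x + s *\<^sub>R \<omega> - z) \<le> \<delta>"
    using diophantine_orbit_dense[OF diophantine_frequency] by blast
  show ?thesis
  proof
    show "0 < max C L" using C by simp
    fix \<delta> :: real and x y assume \<delta>: "0 < \<delta>" "\<delta> \<le> 1"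
    obtain \<theta>0 where \<theta>0: "\<And>s. tor_eq (characteristic g s x) (\<phi> (s *\<^sub>R \<omega> + \<theta>0))"
      using conj[OF in_graph_c_gradient[OF g]] unfolding characteristic_def by blast
    obtain \<theta> where \<theta>: "\<theta> \<in> cbox 0 1" "tor_eq y (\<phi> \<theta>)" by (rule \<phi>_surj_mod)
    obtain s z where s: "s \<in> {0..C * \<delta> powr (- (2 * \<eta>))}" and z: "int_vec z"
      and near: "norm ((\<theta>0 - \<theta>) + s *\<^sub>R \<omega> - z) \<le> \<delta>"
      using dense[OF \<delta>, of "\<theta>0 - \<theta>"] by blast
    define e where "e = (\<theta>0 - \<theta>) + s *\<^sub>R \<omega> - z"
    have e: "norm e \<le> \<delta>" using near by (simp add: e_def)
    have "tor_eq (s *\<^sub>R \<omega> + \<theta>0) (\<theta> + e)" using z by (simp add: tor_eq_def e_def)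
    then have "tor_eq (characteristic g s x) (\<phi> (\<theta> + e))" using \<theta>0 \<phi>_tor_eq tor_eq_trans by blast
    then obtain y' where y': "tor_eq y' y" "y' - characteristic g s x = \<phi> \<theta> - \<phi> (\<theta> + e)"
      using \<theta>(2) by (rule tor_eq_displace)
    have "norm (y' - characteristic g s x) \<le> L * norm e"
      unfolding y'(2) using \<theta>(1) e \<delta>(2) by (intro L(2)) auto
    also have "\<dots> \<le> max C L * \<delta>" using e L(1) by (intro mult_mono) auto
    finally have "norm (y' - characteristic g s x) \<le> max C L * \<delta>" .
    moreover have "s \<in> {0..max C L * \<delta> powr (- (2 * \<eta>))}"
      using s mult_right_mono[of C "max C L" "\<delta> powr (- (2 * \<eta>))"] by auto
    ultimately show "\<exists>s\<in>{0..max C L * \<delta> powr (- (2 * \<eta>))}.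
        \<exists>y'. tor_eq y' y \<and> norm (y' - characteristic g s x) \<le> max C L * \<delta>" using y'(1) by blast
  qed
qed

lemma solutions_bounded:
  obtains K where "0 < K" "\<And>x. \<bar>v x\<bar> \<le> K" "\<And>\<epsilon> u x. 0 < \<epsilon> \<Longrightarrow> discounted_solution \<epsilon> u \<Longrightarrow> \<bar>u x\<bar> \<le> K"
proof -
  obtain g where g: "C1_test v g" "\<And>x. H x (c + g x) = hc" using classical_solution by blast
  note periodic = viscosity_solution_periodic[OF solution]
  have "bounded (range v)"
    using viscosity_solution_continuous[OF solution] periodic
    by (intro compact_imp_bounded compact_range_periodic_fun)
  then obtain B where B: "0 < B" "\<And>x. \<bar>v x\<bar> \<le> B" unfolding bounded_pos by auto
  show ?thesis
  proof
    show "0 < 2 * B" using B(1) by simp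
    show "\<bar>v x\<bar> \<le> 2 * B" for x using B(1) B(2)[of x] by simp
    show "\<bar>u x\<bar> \<le> 2 * B" if "0 < \<epsilon>" "discounted_solution \<epsilon> u" for \<epsilon> u x
      by (rule discounted_solution_bound[OF g periodic B(2) that])
  qed
qed

lemma solutions_lipschitz:
  obtains R where "0 < R" "R-lipschitz_on UNIV v"
    "\<And>\<epsilon> u. 0 < \<epsilon> \<Longrightarrow> \<epsilon> \<le> 1 \<Longrightarrow> discounted_solution \<epsilon> u \<Longrightarrow> R-lipschitz_on UNIV u"
proof -
  obtain K where K: "0 < K" "\<And>x. \<bar>v x\<bar> \<le> K"
    "\<And>\<epsilon> u x. 0 < \<epsilon> \<Longrightarrow> discounted_solution \<epsilon> u \<Longrightarrow> \<bar>u x\<bar> \<le> K"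
    using solutions_bounded by blast
  obtain R where R: "0 < R" and lipschitz: "\<And>u B k'. continuous_on UNIV u \<Longrightarrow> (\<And>x. \<bar>u x\<bar> \<le> B) \<Longrightarrow>
      k' \<le> hc + K \<Longrightarrow> hj_subsolution (\<lambda>x p. H x (c + p)) k' u \<Longrightarrow> R-lipschitz_on UNIV u"
    using tonelli_subsolution_lipschitz[OF tonelli_H, of "hc + K" c] by blast
  show ?thesis
  proof
    have "hj_subsolution (\<lambda>x p. H x (c + p)) hc v"
      using discounted_hj_subsolution[of 0 H c hc v K] solution K(2) by simp
    then show "R-lipschitz_on UNIV v"
      using K by (intro lipschitz[OF viscosity_solution_continuous[OF solution]]) auto
    show "R-lipschitz_on UNIV u" if \<epsilon>: "0 < \<epsilon>" "\<epsilon> \<le> 1" and u: "discounted_solution \<epsilon> u" for \<epsilon> u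
    proof (rule lipschitz[OF viscosity_solution_continuous[OF u] K(3)[OF \<epsilon>(1) u]])
      show "hc + \<epsilon> * K \<le> hc + K" using \<epsilon> K(1) by (simp add: mult_left_le_one_le)
      show "hj_subsolution (\<lambda>x p. H x (c + p)) (hc + \<epsilon> * K) u"
        by (rule discounted_hj_subsolution[OF u K(3)[OF \<epsilon>(1) u]]) (use \<epsilon> in simp)
    qed
  qed (rule R)
qed

lemma discounted_oscillation:
  obtains M where "0 < M"
    "\<And>\<epsilon> \<delta> u x y. 0 < \<epsilon> \<Longrightarrow> \<epsilon> \<le> 1 \<Longrightarrow> 0 < \<delta> \<Longrightarrow> \<delta> \<le> 1 \<Longrightarrow> discounted_solution \<epsilon> u \<Longrightarrow>
      (u y - v y) - (u x - v x) \<le> M * (\<epsilon> * \<delta> powr (- (2 * \<eta>)) + \<delta>)"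
proof -
  obtain g where g: "C1_test v g" "\<And>x. H x (c + g x) = hc" using classical_solution by blast
  obtain K where K: "0 < K" "\<And>\<epsilon> u x. 0 < \<epsilon> \<Longrightarrow> discounted_solution \<epsilon> u \<Longrightarrow> \<bar>u x\<bar> \<le> K"
    by (rule solutions_bounded) blast
  obtain R where R: "0 < R" "R-lipschitz_on UNIV v"
    "\<And>\<epsilon> u. 0 < \<epsilon> \<Longrightarrow> \<epsilon> \<le> 1 \<Longrightarrow> discounted_solution \<epsilon> u \<Longrightarrow> R-lipschitz_on UNIV u"
    by (rule solutions_lipschitz) blast
  obtain C where C: "0 < C" and dense: "\<And>\<delta> x y. 0 < \<delta> \<Longrightarrow> \<delta> \<le> 1 \<Longrightarrow> \<exists>s\<in>{0..C * \<delta> powr (- (2 * \<eta>))}.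
      \<exists>y'. tor_eq y' y \<and> norm (y' - characteristic g s x) \<le> C * \<delta>"
    by (rule characteristics_dense[OF g(1)]) blast
  let ?M = "max K (R + R)"
  show ?thesis
  proof
    show "0 < ?M * C" using K C by simp
    fix \<epsilon> \<delta> :: real and u x y assume \<epsilon>: "0 < \<epsilon>" "\<epsilon> \<le> 1" and \<delta>: "0 < \<delta>" "\<delta> \<le> 1"
      and u: "discounted_solution \<epsilon> u"
    let ?w = "\<lambda>x. u x - v x" and ?T = "C * \<delta> powr (- (2 * \<eta>))"
    note bound = K(2)[OF \<epsilon>(1) u] and lipschitz = R(3)[OF \<epsilon> u]
    obtain s y' where s: "s \<in> {0..?T}"
      and y': "tor_eq y' y" "norm (y' - characteristic g s x) \<le> C * \<delta>"
      using dense[OF \<delta>] by blast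
    have "hj_subsolution (\<lambda>x p. H x (c + p)) (hc + \<epsilon> * K) u"
      by (rule discounted_hj_subsolution[OF u bound]) (use \<epsilon> in simp)
    then have "?w (characteristic g s x) - ?w x \<le> \<epsilon> * K * s"
      using subsolution_growth_along_characteristic[OF g lipschitz bound, of "\<epsilon> * K" s x] s by simp
    also have "\<dots> \<le> \<epsilon> * ?M * ?T" using s \<epsilon> K by (intro mult_mono) auto
    finally have time: "?w (characteristic g s x) - ?w x \<le> \<epsilon> * ?M * ?T" .
    have "periodic_fun ?w"
      using viscosity_solution_periodic[OF u] viscosity_solution_periodic[OF solution]
      by (simp add: periodic_fun_def)
    then have "?w y' = ?w y" using y'(1) by (rule periodic_fun_tor_eq)
    then have "?w y - ?w (characteristic g s x) = ?w y' - ?w (characteristic g s x)" by simp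
    also have "\<dots> \<le> (R + R) * norm (y' - characteristic g s x)"
      using lipschitz_on_normD[OF lipschitz_on_diff[OF lipschitz R(2)], of y' "characteristic g s x"]
      by (simp add: abs_le_iff)
    also have "\<dots> \<le> ?M * (C * \<delta>)" using y'(2) R(1) by (intro mult_mono) auto
    finally have "?w y - ?w (characteristic g s x) \<le> ?M * (C * \<delta>)" .
    with time have "?w y - ?w x \<le> \<epsilon> * ?M * ?T + ?M * (C * \<delta>)" by linarith
    then show "?w y - ?w x \<le> ?M * C * (\<epsilon> * \<delta> powr (- (2 * \<eta>)) + \<delta>)" by (simp add: algebra_simps)
  qed
qed

end

lemma balanced_scale:
  fixes \<epsilon> \<eta> :: real
  assumes "0 < \<epsilon>" "0 < \<eta>" and \<delta>: "\<delta> = \<epsilon> powr (1 / (1 + 2 * \<eta>))"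
  shows "\<epsilon> * \<delta> powr (- (2 * \<eta>)) = \<delta>"
proof -
  have "0 < \<delta>" "\<epsilon> = \<delta> powr (1 + 2 * \<eta>)" using assms by (simp_all add: powr_powr)
  then show ?thesis by (simp add: powr_add[symmetric])
qed

theorem theorem4p5:
  fixes H :: "real^'n \<Rightarrow> real^'n \<Rightarrow> real"
    and c :: "real^'n" and hc :: real
    and v :: "real^'n \<Rightarrow> real"
    and ve :: "real \<Rightarrow> real^'n \<Rightarrow> real"
    and \<nu> \<eta> :: real and \<omega> :: "real^'n"
  assumes "tonelli H"
    and "viscosity_solution (\<lambda>x r p. H x (c + p) - hc) v"
    and "KAM_torus H c v \<nu> \<eta> \<omega>"
    and "\<And>\<epsilon>. \<epsilon> > 0 \<Longrightarrow> viscosity_solution (\<lambda>x r p. \<epsilon> * r + H x (c + p) - hc) (ve \<epsilon>)"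
  shows "\<exists>\<beta>>0. \<forall>\<^sub>F \<epsilon> in at_right 0.
           \<exists>C. \<forall>x. \<bar>ve \<epsilon> x - (v x + C)\<bar> \<le> \<beta> * \<epsilon> powr (1 / (1 + 2 * \<eta>))"
proof -
  interpret kam_solution H c hc v \<nu> \<eta> \<omega> using assms(1-3) by unfold_locales
  have \<eta>: "0 < \<eta>" by (rule diophantine_exponent_pos[OF diophantine_frequency])
  obtain M where M: "0 < M" and oscillation: "\<And>\<epsilon> \<delta> u x y. 0 < \<epsilon> \<Longrightarrow> \<epsilon> \<le> 1 \<Longrightarrow> 0 < \<delta> \<Longrightarrow> \<delta> \<le> 1 \<Longrightarrow>
      viscosity_solution (\<lambda>x r p. \<epsilon> * r + H x (c + p) - hc) u \<Longrightarrow>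
      (u y - v y) - (u x - v x) \<le> M * (\<epsilon> * \<delta> powr (- (2 * \<eta>)) + \<delta>)"
    using discounted_oscillation by blast
  have "\<bar>ve \<epsilon> x - (v x + (ve \<epsilon> 0 - v 0))\<bar> \<le> 2 * M * \<epsilon> powr (1 / (1 + 2 * \<eta>))"
    if \<epsilon>: "0 < \<epsilon>" "\<epsilon> < 1" for \<epsilon> x
  proof -
    define \<delta> where "\<delta> = \<epsilon> powr (1 / (1 + 2 * \<eta>))"
    have "0 < \<delta>" "\<delta> \<le> 1" using \<epsilon> \<eta> by (auto simp: \<delta>_def intro!: powr_le1)
    then have "(ve \<epsilon> y - v y) - (ve \<epsilon> x - v x) \<le> 2 * M * \<delta>" for x y
      using oscillation[of \<epsilon> \<delta> "ve \<epsilon>" y x] balanced_scale[OF \<epsilon>(1) \<eta> \<delta>_def] \<epsilon> assms(4) by simp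
    from this[of x 0] this[of 0 x] show ?thesis
      by (simp add: \<delta>_def abs_le_iff)
  qed
  then have "\<forall>\<^sub>F \<epsilon> in at_right 0. \<exists>C. \<forall>x. \<bar>ve \<epsilon> x - (v x + C)\<bar> \<le> 2 * M * \<epsilon> powr (1 / (1 + 2 * \<eta>))"
    unfolding eventually_at_right_field by (meson zero_less_one)
  then show ?thesis using M by (intro exI[of _ "2 * M"]) simp
qed

end
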